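(* Let $\Sigma$ be either the complex plane $\mathbb{C}$ or the open unit disk $\mathbb{D}=\{z\in\mathbb{C} : |z|<1\}$. Let $X=(X_1,X_2,X_3):\Sigma\to\mathbb{R}^3$ be a conformal minimal immersion with $X_3$ non-constant. Let $K\subset\Sigma$ be a compact set and let $\varepsilon>0$. Then there exists a complete conformal minimal immersion $Y=(Y_1,Y_2,Y_3):\Sigma\to\mathbb{R}^3$ such that (a) $\|X-Y\|<\varepsilon$ on $K$, and (b) $X_3=Y_3$ on $\Sigma$.
   Context: A conformal minimal immersion $X:\Sigma\to\mathbb{R}^3$ is a conformal immersion whose coordinate functions are harmonic. It is complete if the Riemannian metric it induces on $\Sigma$ is complete, i.e. every divergent curve in $\Sigma$ has infinite length with respect to the induced metric. $\|\cdot\|$ denotes the Euclidean norm in $\mathbb{R}^3$. *)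

theory Defs
  imports "HOL-Analysis.Analysis"
begin

text \<open>Identify \<real>^2 with \<complex>: z = x + i y. Partial derivatives in x and y
are given via the Frechet derivative h \<mapsto> Re h * u_x + Im h * u_y.\<close>

definition harmonic_on :: "complex set \<Rightarrow> (complex \<Rightarrow> real) \<Rightarrow> bool" where
  "harmonic_on S u \<longleftrightarrow> open S \<and>
    (\<exists>ux uy uxx uxy uyx uyy.
      (\<forall>z\<in>S. (u has_derivative (\<lambda>h. Re h * ux z + Im h * uy z)) (at z)) \<and>
      (\<forall>z\<in>S. (ux has_derivative (\<lambda>h. Re h * uxx z + Im h * uxy z)) (at z)) \<and>
      (\<forall>z\<in>S. (uy has_derivative (\<lambda>h. Re h * uyx z + Im h * uyy z)) (at z)) \<and>
      continuous_on S uxx \<and> continuous_on S uxy \<and>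
      continuous_on S uyx \<and> continuous_on S uyy \<and>
      (\<forall>z\<in>S. uxx z + uyy z = 0))"

definition conformal_minimal_immersion :: "complex set \<Rightarrow> (complex \<Rightarrow> real^3) \<Rightarrow> bool" where
  "conformal_minimal_immersion S X \<longleftrightarrow> open S \<and>
    (\<forall>k. harmonic_on S (\<lambda>z. X z $ k)) \<and>
    (\<exists>Xx Xy. \<forall>z\<in>S.
       (X has_derivative (\<lambda>h. Re h *\<^sub>R Xx z + Im h *\<^sub>R Xy z)) (at z) \<and>
       norm (Xx z) = norm (Xy z) \<and> Xx z \<bullet> Xy z = 0 \<and> Xx z \<noteq> 0)"

definition divergent_curve :: "complex set \<Rightarrow> (real \<Rightarrow> complex) \<Rightarrow> bool" where
  "divergent_curve S \<gamma> \<longleftrightarrow> continuous_on {0..<1} \<gamma> \<and> \<gamma> ` {0..<1} \<subseteq> S \<and>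
    (\<forall>K. compact K \<and> K \<subseteq> S \<longrightarrow> (\<exists>t0<1. \<forall>t\<in>{t0..<1}. \<gamma> t \<notin> K))"

text \<open>The length of \<gamma> in the metric induced by X (= the length of X \<circ> \<gamma> in \<real>^3,
as a supremum over inscribed polygons) is infinite.\<close>
definition infinite_induced_length :: "(complex \<Rightarrow> real^3) \<Rightarrow> (real \<Rightarrow> complex) \<Rightarrow> bool" where
  "infinite_induced_length X \<gamma> \<longleftrightarrow>
    (\<forall>M::real. \<exists>(n::nat) (ts::nat \<Rightarrow> real).
       0 \<le> ts 0 \<and> (\<forall>i<n. ts i < ts (Suc i)) \<and> ts n < 1 \<and>
       (\<Sum>i<n. norm (X (\<gamma> (ts (Suc i))) - X (\<gamma> (ts i)))) > M)"

definition complete_immersion :: "complex set \<Rightarrow> (complex \<Rightarrow> real^3) \<Rightarrow> bool" where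
  "complete_immersion S X \<longleftrightarrow>
    (\<forall>\<gamma>. divergent_curve S \<gamma> \<longrightarrow> infinite_induced_length X \<gamma>)"

end

theory Submission
  imports Defs "HOL-Complex_Analysis.Complex_Analysis"
    "HOL-Computational_Algebra.Fundamental_Theorem_Algebra"
begin

unbundle no Formal_Power_Series.fps_syntax

text \<open>Write \<open>f k = \<partial>\<^sub>x X\<^sub>k - \<i> \<partial>\<^sub>y X\<^sub>k\<close>; these functions are holomorphic with \<open>\<Sum>(f k)\<^sup>2 = 0\<close>, so
  \<open>A = f 1 - \<i> f 2\<close> and \<open>B = f 1 + \<i> f 2\<close> satisfy \<open>A B = - (f 3)\<^sup>2\<close>. For any holomorphic \<open>h\<close> the
  data \<open>(A e\<^bsup>h\<^esup>, B e\<^bsup>-h\<^esup>, f 3)\<close> integrate to a conformal minimal immersion \<open>Y\<close> with the same third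
  coordinate, whose metric dominates both \<open>|f 3|\<close> and \<open>|A| e\<^bsup>Re h\<^esup>\<close> up to a constant factor. Choose annuli
  exhausting the surface on which \<open>f 3\<close> has no zeros, and in each of them a labyrinth of many concentric
  slit rings. By pole pushing there is an \<open>h\<close>, small on \<open>K\<close>, with \<open>Re h\<close> as large as desired on every
  ring. A divergent curve either crosses a ring, which is long because \<open>e\<^bsup>Re h\<^esup>\<close> is large there, or it
  zigzags through the slits, which is long because \<open>|f 3|\<close> is bounded below and there are many rings.\<close>

section \<open>Harmonic functions\<close>

text \<open>The slits are forced. The mean of \<open>Re h\<close> over a circle about 0 is
  \<open>Re (h 0)\<close>, so a function that is small near 0 cannot have large real part on a full
  ring; every ring needs a gap. In the gaps nothing is gained from \<open>h\<close>, and the only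
  bound left is \<open>|f 3|\<close>, which the deformation does not touch. Hence the gaps alternate
  between two sides, and the number of rings is chosen after the minimum of \<open>|f 3|\<close>.
  That \<open>X_3\<close> is not constant enters as \<open>f 3\<close> not vanishing identically.
  Where \<open>f 3\<close> has no zero, \<open>A\<close> has none either, because
  \<open>A B = - (f 3)^2\<close>; so one annulus serves both lower bounds. The deformation
  multiplies the Gauss map \<open>f 3 / A\<close> by \<open>e^(-h)\<close>: it is the Lopez-Ros
  deformation with a nowhere vanishing function in place of a constant. The factor has no zeros, so
  no branch points arise, and the surface is convex, so the new data integrate without
  periods.\<close>

lemma second_difference_estimate:
  fixes u :: "'a::real_normed_vector \<Rightarrow> real"
  assumes S: "open S" "z \<in> S" and u: "\<And>w. w \<in> S \<Longrightarrow> (u has_derivative D w) (at w)"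
    and E: "((\<lambda>w. D w a) has_derivative E) (at z)" and e: "e > 0"
  shows "\<forall>\<^sub>F t in at_right 0.
    \<bar>u (z + t *\<^sub>R a + t *\<^sub>R b) - u (z + t *\<^sub>R a) - u (z + t *\<^sub>R b) + u z - t\<^sup>2 * E b\<bar> \<le> e * t\<^sup>2"
proof -
  define c where "c = norm a + norm b + 1"
  have c: "c > 0" by (simp add: c_def add_nonneg_pos)
  obtain r where r: "r > 0" "ball z r \<subseteq> S" using S openE by blast
  have "e / (2 * c) > 0" using e c by simp
  then obtain \<delta> where \<delta>: "\<delta> > 0" "\<And>w. norm (w - z) < \<delta> \<Longrightarrow>
      norm (D w a - D z a - E (w - z)) \<le> e / (2 * c) * norm (w - z)"
    using E unfolding has_derivative_at_alt by meson
  have linE: "linear E" using E has_derivative_linear by blast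
  define T where "T = min r \<delta> / c"
  have T: "T > 0" using r \<delta> c by (simp add: T_def)
  have "\<bar>u (z + t *\<^sub>R a + t *\<^sub>R b) - u (z + t *\<^sub>R a) - u (z + t *\<^sub>R b) + u z - t\<^sup>2 * E b\<bar> \<le> e * t\<^sup>2"
    if t: "0 < t" "t < T" for t
  proof -
    have tc: "t * c < r" "t * c < \<delta>" using t c by (auto simp: T_def field_simps)
    have near: "norm (x *\<^sub>R a + y *\<^sub>R b) \<le> t * c" if "0 \<le> x" "x \<le> t" "0 \<le> y" "y \<le> t" for x y
    proof -
      have "norm (x *\<^sub>R a + y *\<^sub>R b) \<le> x * norm a + y * norm b"
        using norm_triangle_ineq[of "x *\<^sub>R a" "y *\<^sub>R b"] that by simp
      also have "\<dots> \<le> t * norm a + t * norm b"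
        using that by (intro add_mono mult_right_mono) auto
      also have "\<dots> \<le> t * c" using t by (simp add: c_def distrib_left)
      finally show ?thesis .
    qed
    have inS: "z + x *\<^sub>R a + y *\<^sub>R b \<in> S" if "0 \<le> x" "x \<le> t" "0 \<le> y" "y \<le> t" for x y
    proof -
      have "dist z (z + x *\<^sub>R a + y *\<^sub>R b) < r"
        using near[OF that] tc(1) by (simp add: dist_commute[of z]) (simp add: dist_norm add.assoc)
      then show ?thesis using r(2) by auto
    qed
    \<comment> \<open>The second difference is \<open>\<phi> t - \<phi> 0\<close>. The mean value
      theorem in direction \<open>a\<close> turns it into a difference of first derivatives at two
      points within \<open>t * c\<close> of \<open>z\<close>. Differentiability of
      \<open>D w a\<close> at \<open>z\<close> then leaves an error of at most
      \<open>e / 2 * t\<close> at each of them.\<close>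
    define \<phi> where "\<phi> = (\<lambda>x. u (z + x *\<^sub>R a + t *\<^sub>R b) - u (z + x *\<^sub>R a + 0 *\<^sub>R b))"
    have dphi: "(\<phi> has_derivative (\<lambda>h. h * (D (z + x *\<^sub>R a + t *\<^sub>R b) a - D (z + x *\<^sub>R a + 0 *\<^sub>R b) a))) (at x)"
      if x: "0 \<le> x" "x \<le> t" for x
    proof -
      have *: "((\<lambda>x. u (z + x *\<^sub>R a + y *\<^sub>R b)) has_derivative (\<lambda>h. h * D (z + x *\<^sub>R a + y *\<^sub>R b) a)) (at x)"
        if y: "0 \<le> y" "y \<le> t" for y
      proof -
        have "((\<lambda>x. z + x *\<^sub>R a + y *\<^sub>R b) has_derivative (\<lambda>h. h *\<^sub>R a)) (at x)"
          by (auto intro!: derivative_eq_intros)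
        from has_derivative_compose[OF this u[OF inS[OF x y]]]
        have "((\<lambda>x. u (z + x *\<^sub>R a + y *\<^sub>R b)) has_derivative
            (\<lambda>h. D (z + x *\<^sub>R a + y *\<^sub>R b) (h *\<^sub>R a))) (at x)" .
        moreover have "linear (D (z + x *\<^sub>R a + y *\<^sub>R b))"
          using u[OF inS[OF x y]] has_derivative_linear by blast
        ultimately show ?thesis by (simp add: linear_scale)
      qed
      show ?thesis unfolding \<phi>_def
        using has_derivative_diff[OF *[of t] *[of 0]] t by (simp add: right_diff_distrib)
    qed
    have "\<exists>\<xi>\<in>{0<..<t}. \<phi> t - \<phi> 0 =
        (t - 0) * (D (z + \<xi> *\<^sub>R a + t *\<^sub>R b) a - D (z + \<xi> *\<^sub>R a + 0 *\<^sub>R b) a)"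
      by (rule mvt_simple[OF t(1)]) (rule has_derivative_at_withinI[OF dphi])
    then obtain \<xi> where \<xi>: "0 < \<xi>" "\<xi> < t"
      "\<phi> t - \<phi> 0 = t * (D (z + \<xi> *\<^sub>R a + t *\<^sub>R b) a - D (z + \<xi> *\<^sub>R a + 0 *\<^sub>R b) a)"
      by auto
    have err: "\<bar>D (z + \<xi> *\<^sub>R a + y *\<^sub>R b) a - D z a - E (\<xi> *\<^sub>R a + y *\<^sub>R b)\<bar> \<le> e / 2 * t"
      if "0 \<le> y" "y \<le> t" for y
    proof -
      have n: "norm (\<xi> *\<^sub>R a + y *\<^sub>R b) \<le> t * c" using near[of \<xi> y] \<xi> that by simp
      then have "\<bar>D (z + \<xi> *\<^sub>R a + y *\<^sub>R b) a - D z a - E (\<xi> *\<^sub>R a + y *\<^sub>R b)\<bar>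
          \<le> e / (2 * c) * norm (\<xi> *\<^sub>R a + y *\<^sub>R b)"
        using \<delta>(2)[of "z + \<xi> *\<^sub>R a + y *\<^sub>R b"] tc(2) by (simp add: add.assoc)
      also have "\<dots> \<le> e / (2 * c) * (t * c)" using n e c by (intro mult_left_mono) auto
      also have "\<dots> = e / 2 * t" using c by simp
      finally show ?thesis .
    qed
    have "E (\<xi> *\<^sub>R a + t *\<^sub>R b) - E (\<xi> *\<^sub>R a + 0 *\<^sub>R b) = t * E b"
      using linE by (simp add: linear_add linear_scale)
    then have "\<bar>D (z + \<xi> *\<^sub>R a + t *\<^sub>R b) a - D (z + \<xi> *\<^sub>R a + 0 *\<^sub>R b) a - t * E b\<bar> \<le> e * t"
      using err[OF less_imp_le[OF t(1)] order_refl] err[OF order_refl less_imp_le[OF t(1)]] by linarith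
    then have "t * \<bar>D (z + \<xi> *\<^sub>R a + t *\<^sub>R b) a - D (z + \<xi> *\<^sub>R a + 0 *\<^sub>R b) a - t * E b\<bar> \<le> t * (e * t)"
      using t by (intro mult_left_mono) auto
    then have "\<bar>\<phi> t - \<phi> 0 - t\<^sup>2 * E b\<bar> \<le> e * t\<^sup>2"
      using t \<xi>(3) by (simp add: power2_eq_square abs_mult_pos' algebra_simps)
    then show ?thesis by (simp add: \<phi>_def algebra_simps)
  qed
  then show ?thesis
    using T unfolding eventually_at_right_field by blast
qed

text \<open>The second difference is symmetric in \<open>a\<close> and \<open>b\<close>, so
  \<open>Ea b\<close> and \<open>Eb a\<close> are both its limit after division by
  \<open>t^2\<close>. In \<open>harmonic_on\<close> the mixed partials \<open>uxy\<close> and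
  \<open>uyx\<close> are separate functions; this identifies them.\<close>

lemma second_derivative_symmetric:
  fixes u :: "'a::real_normed_vector \<Rightarrow> real"
  assumes S: "open S" "z \<in> S" and u: "\<And>w. w \<in> S \<Longrightarrow> (u has_derivative D w) (at w)"
    and Ea: "((\<lambda>w. D w a) has_derivative Ea) (at z)" and Eb: "((\<lambda>w. D w b) has_derivative Eb) (at z)"
  shows "Ea b = Eb a"
proof (rule ccontr)
  assume neq: "Ea b \<noteq> Eb a"
  define e where "e = \<bar>Ea b - Eb a\<bar> / 3"
  have e: "e > 0" using neq by (simp add: e_def)
  have "\<forall>\<^sub>F t in at_right (0::real). t > 0" by (simp add: eventually_at_right_less)
  moreover have "\<forall>\<^sub>F t in at_right 0.
    \<bar>u (z + t *\<^sub>R a + t *\<^sub>R b) - u (z + t *\<^sub>R a) - u (z + t *\<^sub>R b) + u z - t\<^sup>2 * Ea b\<bar> \<le> e * t\<^sup>2"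
    by (rule second_difference_estimate[OF S u Ea e])
  moreover have "\<forall>\<^sub>F t in at_right 0.
    \<bar>u (z + t *\<^sub>R b + t *\<^sub>R a) - u (z + t *\<^sub>R b) - u (z + t *\<^sub>R a) + u z - t\<^sup>2 * Eb a\<bar> \<le> e * t\<^sup>2"
    by (rule second_difference_estimate[OF S u Eb e])
  ultimately have "\<forall>\<^sub>F t in at_right (0::real). False"
  proof eventually_elim
    case (elim t)
    have eq: "z + t *\<^sub>R b + t *\<^sub>R a = z + t *\<^sub>R a + t *\<^sub>R b" by (simp add: algebra_simps)
    have "\<bar>t\<^sup>2 * Ea b - t\<^sup>2 * Eb a\<bar> \<le> 2 * (e * t\<^sup>2)"
      using elim unfolding eq by linarith
    moreover have "\<bar>t\<^sup>2 * Ea b - t\<^sup>2 * Eb a\<bar> = t\<^sup>2 * \<bar>Ea b - Eb a\<bar>"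
      by (simp add: abs_mult flip: right_diff_distrib)
    ultimately have "t\<^sup>2 * \<bar>Ea b - Eb a\<bar> \<le> t\<^sup>2 * (2 * e)" by (simp add: mult_ac)
    then have "\<bar>Ea b - Eb a\<bar> \<le> 2 * e" using elim by simp
    then show ?case using e by (simp add: e_def)
  qed
  then show False by simp
qed

text \<open>For \<open>f = ux - i uy\<close> one Cauchy-Riemann equation is the Laplace equation and
  the other is the symmetry of the mixed partials. The form \<open>Re (f z * h)\<close> of the
  derivative is kept from here on.\<close>

lemma harmonic_on_imp_holomorphic:
  assumes "harmonic_on S u"
  obtains f where "f holomorphic_on S"
    "\<And>z. z \<in> S \<Longrightarrow> (u has_derivative (\<lambda>h. Re (f z * h))) (at z)"
proof -
  obtain ux uy uxx uxy uyx uyy where S: "open S"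
    and "\<forall>z\<in>S. (u has_derivative (\<lambda>h. Re h * ux z + Im h * uy z)) (at z)"
    and "\<forall>z\<in>S. (ux has_derivative (\<lambda>h. Re h * uxx z + Im h * uxy z)) (at z)"
    and "\<forall>z\<in>S. (uy has_derivative (\<lambda>h. Re h * uyx z + Im h * uyy z)) (at z)"
    and "\<forall>z\<in>S. uxx z + uyy z = 0"
    using assms unfolding harmonic_on_def by (elim conjE exE) (rule that)
  note u = bspec[OF this(2)] and ux = bspec[OF this(3)] and uy = bspec[OF this(4)]
    and lap = bspec[OF this(5)]
  define f where "f = (\<lambda>z. Complex (ux z) (- uy z))"
  have "(f has_field_derivative Complex (uxx z) (- uyx z)) (at z)" if z: "z \<in> S" for z
  proof -
    have "Re \<i> * uxx z + Im \<i> * uxy z = Re 1 * uyx z + Im 1 * uyy z"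
      by (rule second_derivative_symmetric[OF S z u, where a = 1 and b = \<i>])
         (use ux[OF z] uy[OF z] in simp_all)
    then have sym: "uxy z = uyx z" by simp
    have "((\<lambda>z. of_real (ux z) - \<i> * of_real (uy z)) has_derivative
        (\<lambda>h. of_real (Re h * uxx z + Im h * uxy z) - \<i> * of_real (Re h * uyx z + Im h * uyy z))) (at z)"
      by (intro derivative_intros ux uy z)
    moreover have "(\<lambda>z. of_real (ux z) - \<i> * of_real (uy z)) = f"
      by (simp add: f_def complex_eq_iff fun_eq_iff)
    moreover have "(\<lambda>h. of_real (Re h * uxx z + Im h * uxy z) - \<i> * of_real (Re h * uyx z + Im h * uyy z))
      = (*) (Complex (uxx z) (- uyx z))"
      using sym lap[OF z] by (simp add: complex_eq_iff fun_eq_iff algebra_simps add_eq_0_iff)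
    ultimately show ?thesis by (simp add: has_field_derivative_def)
  qed
  then have "f holomorphic_on S" using S by (auto simp: holomorphic_on_open)
  moreover have "(u has_derivative (\<lambda>h. Re (f z * h))) (at z)" if "z \<in> S" for z
    using u[OF that] by (simp add: f_def mult.commute)
  ultimately show ?thesis using that by blast
qed

lemma harmonic_on_Re_primitive:
  assumes S: "open S" and f: "f holomorphic_on S"
    and u: "\<And>z. z \<in> S \<Longrightarrow> (u has_derivative (\<lambda>h. Re (f z * h))) (at z)"
  shows "harmonic_on S u"
proof -
  have fd: "(f has_derivative (\<lambda>h. deriv f z * h)) (at z)" if "z \<in> S" for z
    using holomorphic_derivI[OF f S that] by (simp add: has_field_derivative_def)
  have Re_d: "((\<lambda>z. Re (f z)) has_derivative (\<lambda>h. Re h * Re (deriv f z) + Im h * (- Im (deriv f z)))) (at z)"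
    if "z \<in> S" for z
    using has_derivative_compose[OF fd[OF that] bounded_linear_imp_has_derivative[OF bounded_linear_Re]]
    by (simp add: algebra_simps)
  have Im_d: "((\<lambda>z. - Im (f z)) has_derivative (\<lambda>h. Re h * (- Im (deriv f z)) + Im h * (- Re (deriv f z)))) (at z)"
    if "z \<in> S" for z
    using has_derivative_minus[OF has_derivative_compose[OF fd[OF that] bounded_linear_imp_has_derivative[OF bounded_linear_Im]]]
    by (simp add: algebra_simps)
  have cont: "continuous_on S (deriv f)"
    using holomorphic_deriv[OF f S] holomorphic_on_imp_continuous_on by blast
  show ?thesis
    unfolding harmonic_on_def
  proof (intro conjI exI)
    show "\<forall>z\<in>S. (u has_derivative (\<lambda>h. Re h * Re (f z) + Im h * (- Im (f z)))) (at z)"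
      using u by (simp add: algebra_simps)
    show "\<forall>z\<in>S. ((\<lambda>z. Re (f z)) has_derivative (\<lambda>h. Re h * Re (deriv f z) + Im h * (- Im (deriv f z)))) (at z)"
      using Re_d by blast
    show "\<forall>z\<in>S. ((\<lambda>z. - Im (f z)) has_derivative (\<lambda>h. Re h * (- Im (deriv f z)) + Im h * (- Re (deriv f z)))) (at z)"
      using Im_d by blast
  qed (auto intro!: continuous_intros cont S)
qed

section \<open>Polynomial approximation\<close>

text \<open>Membership in the uniform closure of the polynomials on \<open>L\<close>. Its closure
  under sums, products (for compact \<open>L\<close>) and uniform limits is what makes pole pushing
  work: only the poles of one explicit rational function have to be moved.\<close>

definition poly_approx :: "complex set \<Rightarrow> (complex \<Rightarrow> complex) \<Rightarrow> bool" where
  "poly_approx L f \<longleftrightarrow> (\<forall>e>0. \<exists>p. \<forall>z\<in>L. norm (poly p z - f z) < e)"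

lemma poly_approx_poly: "poly_approx L (poly p)"
  unfolding poly_approx_def by (metis diff_self norm_zero)

lemma poly_approx_const: "poly_approx L (\<lambda>z. c)"
  using poly_approx_poly[of L "[:c:]"] by (simp add: poly_approx_def)

lemma poly_approx_cong:
  assumes "poly_approx L f" "\<And>z. z \<in> L \<Longrightarrow> f z = g z"
  shows "poly_approx L g"
  using assms by (simp add: poly_approx_def)

lemma poly_approx_add:
  assumes "poly_approx L f" "poly_approx L g"
  shows "poly_approx L (\<lambda>z. f z + g z)"
  unfolding poly_approx_def
proof (intro allI impI)
  fix e :: real assume "e > 0"
  then obtain p q where p: "\<forall>z\<in>L. norm (poly p z - f z) < e/2"
    and q: "\<forall>z\<in>L. norm (poly q z - g z) < e/2"
    using assms unfolding poly_approx_def by (meson half_gt_zero)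
  have "norm (poly (p + q) z - (f z + g z)) < e" if "z \<in> L" for z
  proof -
    have "norm ((poly p z - f z) + (poly q z - g z)) < e/2 + e/2"
      by (rule norm_add_less) (use p q that in auto)
    then show ?thesis by (simp add: algebra_simps)
  qed
  then show "\<exists>r. \<forall>z\<in>L. norm (poly r z - (f z + g z)) < e" by blast
qed

lemma poly_bounded_compact:
  fixes p :: "complex poly"
  assumes "compact L"
  obtains M where "M > 0" "\<And>z. z \<in> L \<Longrightarrow> norm (poly p z) \<le> M"
proof -
  have "bounded ((\<lambda>z. poly p z) ` L)"
    by (intro compact_imp_bounded compact_continuous_image assms continuous_at_imp_continuous_on ballI poly_isCont)
  then show ?thesis using that by (auto simp: bounded_pos)
qed

lemma poly_approx_mult:
  assumes L: "compact L" and f: "poly_approx L f" and g: "poly_approx L g"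
  shows "poly_approx L (\<lambda>z. f z * g z)"
  unfolding poly_approx_def
proof (intro allI impI)
  fix e :: real assume e: "e > 0"
  \<comment> \<open>No bound on \<open>g\<close> is given; the crude approximant \<open>q0\<close>
    supplies \<open>M + 1\<close>. Then \<open>p\<close> is chosen against the bound on
    \<open>g\<close>, and afterwards \<open>q\<close> against the bound on \<open>p\<close>.\<close>
  obtain q0 where q0: "\<forall>z\<in>L. norm (poly q0 z - g z) < 1"
    using g unfolding poly_approx_def by (meson zero_less_one)
  obtain M where M: "M > 0" "\<And>z. z \<in> L \<Longrightarrow> norm (poly q0 z) \<le> M"
    using poly_bounded_compact[OF L] by blast
  have gM: "norm (g z) \<le> M + 1" if "z \<in> L" for z
  proof -
    have "norm (g z) \<le> norm (poly q0 z) + norm (poly q0 z - g z)"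
      by (metis norm_triangle_sub norm_minus_commute add.commute)
    then show ?thesis using M(2)[OF that] q0 that by fastforce
  qed
  have "e / (2 * (M + 1)) > 0" using e M by auto
  then obtain p where p: "\<forall>z\<in>L. norm (poly p z - f z) < e / (2 * (M + 1))"
    using f unfolding poly_approx_def by meson
  obtain P where P: "P > 0" "\<And>z. z \<in> L \<Longrightarrow> norm (poly p z) \<le> P"
    using poly_bounded_compact[OF L] by blast
  have "e / (2 * P) > 0" using e P by auto
  then obtain q where q: "\<forall>z\<in>L. norm (poly q z - g z) < e / (2 * P)"
    using g unfolding poly_approx_def by meson
  have "norm (poly (p * q) z - f z * g z) < e" if z: "z \<in> L" for z
  proof -
    have "poly (p * q) z - f z * g z = poly p z * (poly q z - g z) + (poly p z - f z) * g z"
      by (simp add: algebra_simps)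
    moreover have "norm (poly p z * (poly q z - g z)) < e / 2"
    proof -
      have "norm (poly p z * (poly q z - g z)) \<le> P * norm (poly q z - g z)"
        using P(2)[OF z] by (simp add: norm_mult mult_right_mono)
      also have "\<dots> < P * (e / (2 * P))" using q z P by (intro mult_strict_left_mono) auto
      finally show ?thesis using P by (simp add: field_simps)
    qed
    moreover have "norm ((poly p z - f z) * g z) \<le> e / 2"
    proof -
      have "norm ((poly p z - f z) * g z) \<le> e / (2 * (M + 1)) * (M + 1)"
        unfolding norm_mult using p z gM[OF z] M e
        by (intro mult_mono) (auto intro: less_imp_le)
      also have "\<dots> = e / 2" using M by (simp add: field_simps)
      finally show ?thesis .
    qed
    ultimately show ?thesis using norm_triangle_le by (smt (verit) field_sum_of_halves norm_triangle_ineq)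
  qed
  then show "\<exists>r. \<forall>z\<in>L. norm (poly r z - f z * g z) < e" by blast
qed

lemma poly_approx_power:
  assumes "compact L" "poly_approx L f"
  shows "poly_approx L (\<lambda>z. f z ^ n)"
  by (induction n) (use assms poly_approx_const poly_approx_mult in auto)

lemma poly_approx_sum:
  assumes "\<And>i. i \<in> I \<Longrightarrow> poly_approx L (f i)"
  shows "poly_approx L (\<lambda>z. \<Sum>i\<in>I. f i z)"
  using assms by (induction I rule: infinite_finite_induct)
    (auto intro: poly_approx_const poly_approx_add)

lemma poly_approx_prod:
  assumes "compact L" "\<And>i. i \<in> I \<Longrightarrow> poly_approx L (f i)"
  shows "poly_approx L (\<lambda>z. \<Prod>i\<in>I. f i z)"
  using assms(2) by (induction I rule: infinite_finite_induct)
    (auto intro: poly_approx_const poly_approx_mult assms(1))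

lemma poly_approx_uniform_limit:
  assumes "\<And>n. poly_approx L (g n)" "uniform_limit L g f sequentially"
  shows "poly_approx L f"
  unfolding poly_approx_def
proof (intro allI impI)
  fix e :: real assume e: "e > 0"
  then have "\<forall>\<^sub>F n in sequentially. \<forall>z\<in>L. dist (g n z) (f z) < e/2"
    using uniform_limitD[OF assms(2), of "e/2"] by simp
  then obtain n where n: "\<forall>z\<in>L. dist (g n z) (f z) < e/2"
    using eventually_happens'[OF sequentially_bot] by blast
  obtain p where p: "\<forall>z\<in>L. norm (poly p z - g n z) < e/2"
    using assms(1)[of n] e unfolding poly_approx_def by (meson half_gt_zero)
  have "norm (poly p z - f z) < e" if "z \<in> L" for z
    using norm_diff_triangle_less[of "poly p z" "g n z" "e/2" "f z" "e/2"] p n that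
    by (auto simp: dist_norm)
  then show "\<exists>p. \<forall>z\<in>L. norm (poly p z - f z) < e" by blast
qed

lemma uniform_limit_geometric:
  fixes w :: "'a \<Rightarrow> complex"
  assumes "0 \<le> q" "q < 1" "\<And>z. z \<in> L \<Longrightarrow> norm (w z) \<le> q"
  shows "uniform_limit L (\<lambda>n z. \<Sum>k<n. w z ^ k) (\<lambda>z. 1 / (1 - w z)) sequentially"
proof -
  have "uniform_limit L (\<lambda>n z. \<Sum>k<n. w z ^ k) (\<lambda>z. \<Sum>k. w z ^ k) sequentially"
  proof (rule Weierstrass_m_test)
    show "norm (w z ^ k) \<le> q ^ k" if "z \<in> L" for k z
      using assms(3)[OF that] by (simp add: norm_power power_mono)
    show "summable (\<lambda>k. q ^ k)" using assms by (simp add: summable_geometric)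
  qed
  moreover have "(\<Sum>k. w z ^ k) = 1 / (1 - w z)" if "z \<in> L" for z
    using assms(3)[OF that] assms(2) by (intro suminf_geometric) auto
  ultimately show ?thesis by (simp cong: uniform_limit_cong')
qed

lemma poly_approx_geometric:
  assumes "compact L" "poly_approx L w" "q < 1" "\<And>z. z \<in> L \<Longrightarrow> norm (w z) \<le> q"
  shows "poly_approx L (\<lambda>z. 1 / (1 - w z))"
proof (rule poly_approx_uniform_limit)
  show "uniform_limit L (\<lambda>n z. \<Sum>k<n. w z ^ k) (\<lambda>z. 1 / (1 - w z)) sequentially"
    by (rule uniform_limit_geometric[of "max q 0"]) (use assms in \<open>fastforce+\<close>)
  show "poly_approx L (\<lambda>z. \<Sum>k<n. w z ^ k)" for n
    by (intro poly_approx_sum poly_approx_power assms)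
qed

text \<open>With \<open>w = (b - a) / (z - a)\<close> one has
  \<open>1 / (z - b) = 1 / (z - a) * (1 / (1 - w))\<close>, and
  \<open>norm w \<le> norm (b - a) / d < 1\<close> on \<open>L\<close>, so the geometric series in
  \<open>w\<close> converges uniformly.\<close>

lemma poly_approx_push_pole:
  assumes L: "compact L" and a: "poly_approx L (\<lambda>z. 1 / (z - a))"
    and d: "\<And>z. z \<in> L \<Longrightarrow> d \<le> norm (z - a)" and b: "norm (b - a) < d"
  shows "poly_approx L (\<lambda>z. 1 / (z - b))"
proof -
  have dpos: "d > 0" using b norm_ge_zero le_less_trans by blast
  define w where "w = (\<lambda>z. (b - a) * (1 / (z - a)))"
  have "poly_approx L (\<lambda>z. 1 / (1 - w z))"
  proof (rule poly_approx_geometric[OF L])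
    show "poly_approx L w"
      unfolding w_def by (intro poly_approx_mult poly_approx_const L a)
    show "norm (b - a) / d < 1" using b dpos by simp
    show "norm (w z) \<le> norm (b - a) / d" if "z \<in> L" for z
      using d[OF that] dpos by (simp add: w_def norm_mult norm_divide frac_le)
  qed
  then have "poly_approx L (\<lambda>z. 1 / (z - a) * (1 / (1 - w z)))"
    by (rule poly_approx_mult[OF L a])
  moreover have "1 / (z - a) * (1 / (1 - w z)) = 1 / (z - b)" if "z \<in> L" for z
  proof -
    have "z \<noteq> a" using d[OF that] dpos by auto
    then have "(z - a) * (1 - w z) = z - b" by (simp add: w_def field_simps)
    then show ?thesis by simp
  qed
  ultimately show ?thesis by (rule poly_approx_cong)
qed

text \<open>Expansion in powers of \<open>z / b\<close>. This is where pole pushing starts: poles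
  far away are harmless.\<close>

lemma poly_approx_far_pole:
  assumes L: "compact L" and M: "\<And>z. z \<in> L \<Longrightarrow> norm z \<le> M" and b: "norm b > M" "b \<noteq> 0"
  shows "poly_approx L (\<lambda>z. 1 / (z - b))"
proof -
  have "poly_approx L (\<lambda>z. 1 / (1 - z / b))"
  proof (rule poly_approx_geometric[OF L])
    show "poly_approx L (\<lambda>z. z / b)"
      by (rule poly_approx_cong[OF poly_approx_poly[of L "[:0, 1/b:]"]]) simp
    show "M / norm b < 1" using b by simp
    show "norm (z / b) \<le> M / norm b" if "z \<in> L" for z
      using M[OF that] by (simp add: norm_divide divide_right_mono)
  qed
  then have "poly_approx L (\<lambda>z. (- 1 / b) * (1 / (1 - z / b)))"
    by (intro poly_approx_mult poly_approx_const L)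
  moreover have "(- 1 / b) * (1 / (1 - z / b)) = 1 / (z - b)" for z
  proof -
    have "(- b) * (1 - z / b) = z - b" using b(2) by (simp add: field_simps)
    then have "1 / (z - b) = 1 / ((- b) * (1 - z / b))" by simp
    then show ?thesis by (simp add: divide_inverse mult.commute)
  qed
  ultimately show ?thesis by simp
qed

text \<open>Short pushes go both ways, so inside \<open>- L\<close> the admissible poles and the
  inadmissible ones both form open sets. The connected set \<open>V\<close> lies in one of them, and
  being unbounded it contains a far, admissible pole.\<close>

lemma poly_approx_pole_connected:
  assumes L: "compact L" and V: "connected V" "V \<inter> L = {}" "\<not> bounded V" and a: "a \<in> V"
  shows "poly_approx L (\<lambda>z. 1 / (z - a))"
proof -
  define U where "U = {b. b \<notin> L \<and> poly_approx L (\<lambda>z. 1 / (z - b))}"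
  have sep: "\<exists>d>0. \<forall>z\<in>L. 2 * d \<le> norm (z - b)" if b: "b \<notin> L" for b
  proof -
    have "open (- L)" using L compact_imp_closed by blast
    then obtain e where e: "e > 0" "ball b e \<subseteq> - L" using b by (metis ComplI openE)
    have "2 * (e / 2) \<le> norm (z - b)" if "z \<in> L" for z
    proof -
      have "z \<notin> ball b e" using e(2) that by blast
      then show ?thesis by (simp add: dist_norm norm_minus_commute)
    qed
    then show ?thesis using e(1) half_gt_zero by blast
  qed
  \<comment> \<open>The margin \<open>2 * d\<close> keeps every point within \<open>d\<close> of
    \<open>b\<close> at distance more than \<open>d\<close> from \<open>L\<close>, so a pole can be
    pushed from \<open>b\<close> to \<open>b'\<close> and also back.\<close>
  have far: "norm (b - b') < d \<Longrightarrow> b' \<notin> L \<and> (\<forall>z\<in>L. d < norm (z - b'))"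
    if "d > 0" "\<forall>z\<in>L. 2 * d \<le> norm (z - b)" for d b b'
  proof -
    assume n: "norm (b - b') < d"
    have "d < norm (z - b')" if "z \<in> L" for z
    proof -
      have "norm (z - b) \<le> norm (z - b') + norm (b' - b)"
        by (metis norm_triangle_ineq add_diff_eq diff_add_cancel)
      moreover have "2 * d \<le> norm (z - b)" using \<open>\<forall>z\<in>L. 2 * d \<le> norm (z - b)\<close> that by blast
      ultimately show ?thesis using n norm_minus_commute[of b b'] by linarith
    qed
    then show ?thesis using \<open>d > 0\<close> by fastforce
  qed
  have "open U"
    unfolding open_contains_ball
  proof
    fix b assume b: "b \<in> U"
    then obtain d where d: "d > 0" "\<forall>z\<in>L. 2 * d \<le> norm (z - b)"
      using sep unfolding U_def by blast
    have "b' \<in> U" if "norm (b - b') < d" for b'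
      unfolding U_def using far[OF d that] b d that
      by (auto simp: U_def norm_minus_commute intro!: poly_approx_push_pole[OF L, of b "2*d"])
    then show "\<exists>e>0. ball b e \<subseteq> U" using d(1) by (auto simp: dist_norm)
  qed
  moreover have "open (- L - U)"
    unfolding open_contains_ball
  proof
    fix b assume b: "b \<in> - L - U"
    then obtain d where d: "d > 0" "\<forall>z\<in>L. 2 * d \<le> norm (z - b)"
      using sep by blast
    have "b' \<in> - L - U" if "norm (b - b') < d" for b'
    proof -
      have "b' \<notin> U"
      proof
        assume "b' \<in> U"
        then have "poly_approx L (\<lambda>z. 1 / (z - b'))" by (simp add: U_def)
        moreover have "\<And>z. z \<in> L \<Longrightarrow> d \<le> norm (z - b')"
          using far[OF d that] by (meson less_imp_le)
        ultimately have "poly_approx L (\<lambda>z. 1 / (z - b))"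
          using that by (rule poly_approx_push_pole[OF L])
        then show False using b unfolding U_def by blast
      qed
      then show ?thesis using far[OF d that] by blast
    qed
    then show "\<exists>e>0. ball b e \<subseteq> - L - U" using d(1) by (auto simp: dist_norm)
  qed
  moreover have "V \<subseteq> U \<union> (- L - U)" using V by blast
  ultimately have "U \<inter> V = {} \<or> (- L - U) \<inter> V = {}"
    by (intro connectedD[OF V(1)]) auto
  moreover have "U \<inter> V \<noteq> {}"
  proof -
    obtain M where M: "M > 0" "\<And>z. z \<in> L \<Longrightarrow> norm z \<le> M"
      using compact_imp_bounded[OF L] by (auto simp: bounded_pos)
    obtain b where b: "b \<in> V" "norm b > M"
      using V(3) unfolding bounded_iff by (meson not_le)
    then have "b \<in> U" using M V(2) by (auto simp: U_def intro!: poly_approx_far_pole[OF L M(2)])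
    then show ?thesis using b by blast
  qed
  ultimately show ?thesis using a V unfolding U_def by blast
qed

text \<open>Over the complex numbers \<open>p\<close> splits into linear factors, so
  \<open>1 / p\<close> is a product of powers of simple poles; multiplicative closure then suffices,
  without partial fractions.\<close>

lemma poly_approx_inverse_poly:
  assumes L: "compact L" and V: "connected V" "V \<inter> L = {}" "\<not> bounded V"
    and p: "p \<noteq> 0" "\<And>a. poly p a = 0 \<Longrightarrow> a \<in> V"
  shows "poly_approx L (\<lambda>z. 1 / poly p z)"
proof -
  define R where "R = {a. poly p a = 0}"
  have "poly_approx L (\<lambda>z. (1 / lead_coeff p) * (\<Prod>a\<in>R. (1 / (z - a)) ^ order a p))"
    by (intro poly_approx_mult poly_approx_const poly_approx_prod poly_approx_power
        poly_approx_pole_connected[OF L V] L) (use p in \<open>auto simp: R_def\<close>)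
  moreover have "(1 / lead_coeff p) * (\<Prod>a\<in>R. (1 / (z - a)) ^ order a p) = 1 / poly p z" for z
  proof -
    have "poly p z = lead_coeff p * (\<Prod>a\<in>R. (z - a) ^ order a p)"
      unfolding R_def
      by (subst complex_poly_decompose[of p, symmetric]) (simp add: poly_prod)
    then show ?thesis by (simp add: power_divide prod_dividef)
  qed
  ultimately show ?thesis by simp
qed

text \<open>The function \<open>z^N / (z^N - r^N)\<close> is nearly 0 inside the circle of radius
  \<open>r\<close> and nearly 1 outside, so a multiple of it switches from small to large between
  \<open>\<rho>\<close> and \<open>\<rho>'\<close>. Its poles lie on that circle and escape to
  infinity on the side where \<open>s * Re z > c\<close>, which the outer region avoids.\<close>

lemma layer_polynomial:
  fixes \<rho> \<rho>' \<rho>'' c s M e :: real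
  assumes \<rho>: "0 < \<rho>" "\<rho> < \<rho>'" "\<rho>' \<le> \<rho>''" and c: "c \<le> \<rho>" and s: "s = 1 \<or> s = -1" and e: "e > 0"
  obtains p where "\<And>z. norm z \<le> \<rho> \<Longrightarrow> norm (poly p z) < e"
    "\<And>z. \<rho>' \<le> norm z \<Longrightarrow> norm z \<le> \<rho>'' \<Longrightarrow> s * Re z \<le> c \<Longrightarrow> Re (poly p z) \<ge> M"
proof -
  define K where "K = {z. \<rho>' \<le> norm z \<and> norm z \<le> \<rho>'' \<and> s * Re z \<le> c}"
  define L where "L = cball 0 \<rho> \<union> K"
  have "closed K" unfolding K_def
    by (intro closed_Collect_conj closed_Collect_le continuous_intros)
  moreover have "bounded K" unfolding K_def bounded_iff by blast
  ultimately have L: "compact L"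
    unfolding L_def by (intro compact_Un compact_cball) (simp add: compact_eq_bounded_closed)
  \<comment> \<open>\<open>V1\<close> contains the poles, \<open>V2\<close> leads out through the
    gap, since \<open>s * Re z > \<rho> \<ge> c\<close> there, and \<open>V3\<close> is the
    exterior. Consecutive pieces overlap.\<close>
  define V1 V2 V3 where "V1 = {z::complex. \<rho> < norm z \<and> norm z < \<rho>'}"
    and "V2 = {z::complex. s * Re z > \<rho>}" and "V3 = {z::complex. norm z > \<rho>''}"
  define V where "V = V1 \<union> V2 \<union> V3"
  have "connected V1"
    using connected_annulus(1)[where 'N=complex, of \<rho> 0 \<rho>'] by (simp add: V1_def)
  moreover have "convex V2"
  proof -
    have "V2 = {z. inner (of_real s) z > \<rho>}" by (auto simp: V2_def inner_complex_def)
    then show ?thesis by (simp add: convex_halfspace_gt)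
  qed
  moreover have "connected V3"
  proof -
    have "V3 = - cball 0 \<rho>''" by (auto simp: V3_def)
    then show ?thesis using connected_complement_bounded_convex[of "cball 0 \<rho>'' :: complex set"] by auto
  qed
  moreover have "of_real (s * ((\<rho> + \<rho>')/2)) \<in> V1 \<inter> V2" "of_real (s * (\<rho>'' + 1)) \<in> V2 \<inter> V3"
    using s \<rho> by (auto simp: V1_def V2_def V3_def simp del: of_real_mult)
  ultimately have "connected V" unfolding V_def
    using connected_Un[of V1 V2] connected_Un[of "V1 \<union> V2" V3] convex_connected by blast
  have VL: "V \<inter> L = {}"
  proof -
    have "s * Re z \<le> norm z" for z
      using s abs_Re_le_cmod[of z] by (auto simp: abs_le_iff)
    moreover have "norm z \<le> \<rho> \<or> \<rho>' \<le> norm z \<and> norm z \<le> \<rho>'' \<and> s * Re z \<le> \<rho>" if "z \<in> L" for z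
      using that c by (auto simp: L_def K_def)
    ultimately have "z \<notin> V" if "z \<in> L" for z
      using that \<rho> unfolding V_def V1_def V2_def V3_def
      by (smt (verit) Un_iff mem_Collect_eq)
    then show ?thesis by blast
  qed
  have Vub: "\<not> bounded V"
  proof
    assume "bounded V"
    then have "bounded (V3 \<union> cball 0 \<rho>'')" by (simp add: V_def)
    moreover have "V3 \<union> cball 0 \<rho>'' = UNIV" by (auto simp: V3_def)
    ultimately show False by simp
  qed
  define r where "r = (\<rho> + \<rho>') / 2"
  have r: "0 < r" "\<rho> < r" "r < \<rho>'" using \<rho> by (auto simp: r_def)
  \<comment> \<open>On the outer region the quotient has real part at least \<open>1 / 2\<close>, so
    the factor \<open>2 * T\<close> yields \<open>T\<close>; the summand 1 pays for the
    approximation error.\<close>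
  define T where "T = \<bar>M\<bar> + 1"
  have T: "T > 0" by (simp add: T_def)
  have "(\<lambda>N. (\<rho> / r) ^ N) \<longlonglongrightarrow> 0" "(\<lambda>N. (r / \<rho>') ^ N) \<longlonglongrightarrow> 0"
    using \<rho> r by (auto intro!: LIMSEQ_power_zero)
  note this[THEN order_tendstoD(2)]
  \<comment> \<open>For \<open>x = (\<rho> / r)^N < 1 / 2\<close> the denominator is at least
    \<open>r^N / 2\<close> on the inner disc, so the function is at most
    \<open>4 * T * x < e / 2\<close> there. The bound \<open>1 / 3\<close> makes
    \<open>r^N / P\<close> at most \<open>1 / 2\<close> on the outer region.\<close>
  from this(1)[of "min (1/2) (e / (8 * T))"] this(2)[of "1/3"]
  have "\<forall>\<^sub>F N in sequentially. (\<rho> / r) ^ N < min (1/2) (e / (8 * T))"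
    "\<forall>\<^sub>F N in sequentially. (r / \<rho>') ^ N < 1/3"
    using e T by simp_all
  then have "\<forall>\<^sub>F N in sequentially. (\<rho> / r) ^ N < min (1/2) (e / (8 * T)) \<and> (r / \<rho>') ^ N < 1/3 \<and> N > 0"
    using eventually_gt_at_top[of 0] by eventually_elim auto
  then obtain N where N: "(\<rho> / r) ^ N < min (1/2) (e / (8 * T))" "(r / \<rho>') ^ N < 1/3" "N > 0"
    using eventually_happens'[OF sequentially_bot] by blast
  define P where "P = monom 1 N - [:complex_of_real r ^ N:]"
  have P: "poly P z = z ^ N - of_real r ^ N" for z by (simp add: P_def poly_monom)
  have "poly_approx L (\<lambda>z. of_real (2 * T) * poly (monom 1 N) z * (1 / poly P z))"
  proof (intro poly_approx_mult poly_approx_inverse_poly[OF L \<open>connected V\<close> VL Vub] L)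
    show "poly_approx L (poly (monom 1 N))" by (rule poly_approx_poly)
    show "poly_approx L (\<lambda>z. of_real (2 * T))" by (rule poly_approx_const)
    have "poly P 0 \<noteq> 0" using N(3) r by (simp add: P power_0_left)
    then show "P \<noteq> 0" by auto
    show "a \<in> V" if "poly P a = 0" for a
    proof -
      have "norm (a ^ N) = norm (complex_of_real r ^ N)" using that by (simp add: P)
      then have "norm a ^ N = r ^ N" using r by (simp add: norm_power)
      then have "norm a = r" using N(3) r by (simp add: power_eq_iff_eq_base)
      then show ?thesis using r by (simp add: V_def V1_def)
    qed
  qed
  then have "poly_approx L (\<lambda>z. of_real (2 * T) * (z ^ N / poly P z))"
    by (simp add: poly_monom)
  moreover have "min (e/2) 1 > 0" using e by auto
  ultimately obtain p where
    p: "\<forall>z\<in>L. norm (poly p z - of_real (2 * T) * (z ^ N / poly P z)) < min (e/2) 1"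
    unfolding poly_approx_def by meson
  show ?thesis
  proof
    fix z :: complex assume z: "norm z \<le> \<rho>"
    define x where "x = (\<rho> / r) ^ N"
    have x: "x \<ge> 0" "x < 1/2" "x < e / (8 * T)" using N(1) \<rho> r by (auto simp: x_def)
    have zN: "norm (z ^ N) \<le> x * r ^ N"
      using z \<rho> r by (simp add: norm_power x_def power_divide power_mono)
    have "r ^ N \<le> norm (poly P z) + norm (z ^ N)"
      using norm_triangle_ineq2[of "complex_of_real r ^ N" "z ^ N"] r
      by (simp add: P norm_power norm_minus_commute)
    then have "norm (poly P z) \<ge> (1 - x) * r ^ N" using zN by (simp add: algebra_simps)
    moreover have "(1 - x) * r ^ N \<ge> (1/2) * r ^ N" using x r by (intro mult_right_mono) auto
    ultimately have Pz: "norm (poly P z) \<ge> r ^ N / 2" by simp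
    have "norm (z ^ N / poly P z) \<le> x * r ^ N / (r ^ N / 2)"
      unfolding norm_divide using Pz zN r x by (intro frac_le) auto
    also have "\<dots> = 2 * x" using r by simp
    finally have "norm (z ^ N / poly P z) \<le> 2 * x" .
    then have "norm (of_real (2 * T) * (z ^ N / poly P z)) \<le> 2 * T * (2 * x)"
      unfolding norm_mult using T by (intro mult_mono) auto
    also have "\<dots> < e / 2" using x(3) T by (simp add: field_simps)
    finally have "norm (of_real (2 * T) * (z ^ N / poly P z)) < e / 2" .
    moreover have "norm (poly p z - of_real (2 * T) * (z ^ N / poly P z)) < e / 2"
      using p z by (auto simp: L_def)
    ultimately show "norm (poly p z) < e"
      by (smt (verit) field_sum_of_halves norm_triangle_sub)
  next
    fix z :: complex assume z: "\<rho>' \<le> norm z" "norm z \<le> \<rho>''" "s * Re z \<le> c"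
    define y where "y = (r / \<rho>') ^ N"
    have y: "y \<ge> 0" "y < 1/3" using N(2) \<rho> r by (auto simp: y_def)
    have zpos: "norm z ^ N > 0" using z \<rho> by (intro zero_less_power) linarith
    have rN: "r ^ N \<le> y * norm z ^ N"
    proof -
      have "r ^ N = y * \<rho>' ^ N" using \<rho> by (simp add: y_def power_divide)
      also have "\<dots> \<le> y * norm z ^ N" using z \<rho> y by (intro mult_left_mono power_mono) auto
      finally show ?thesis .
    qed
    have "y * norm z ^ N \<le> (1/3) * norm z ^ N" using y by (intro mult_right_mono) auto
    then have r3: "r ^ N \<le> norm z ^ N / 3" using rN by simp
    have "norm z ^ N \<le> norm (poly P z) + r ^ N"
      using norm_triangle_ineq2[of "z ^ N" "complex_of_real r ^ N"] r
      by (simp add: P norm_power)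
    then have Pz: "norm (poly P z) \<ge> 2 * norm z ^ N / 3" using r3 by simp
    then have P0: "poly P z \<noteq> 0" using zpos by auto
    have "z ^ N / poly P z = 1 + of_real r ^ N / poly P z"
      using P0 by (simp add: P field_simps)
    moreover have "norm (of_real r ^ N / poly P z) \<le> 1 / 2"
    proof -
      have "norm (of_real r ^ N / poly P z) \<le> (norm z ^ N / 3) / (2 * norm z ^ N / 3)"
        unfolding norm_divide using Pz r3 zpos r by (intro frac_le) (auto simp: norm_power)
      also have "\<dots> = 1 / 2" using zpos by (auto simp: field_simps power_0_left split: if_splits)
      finally show ?thesis .
    qed
    ultimately have "Re (z ^ N / poly P z) \<ge> 1 / 2"
      using abs_Re_le_cmod[of "of_real r ^ N / poly P z"] by simp
    then have "2 * T * Re (z ^ N / poly P z) \<ge> 2 * T * (1 / 2)"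
      using T by (intro mult_left_mono) auto
    then have "Re (of_real (2 * T) * (z ^ N / poly P z)) \<ge> T"
      by (simp only: Re_complex_of_real Im_complex_of_real times_complex.sel)
    moreover have "norm (poly p z - of_real (2 * T) * (z ^ N / poly P z)) < 1"
      using p z by (auto simp: L_def K_def)
    then have "\<bar>Re (poly p z - of_real (2 * T) * (z ^ N / poly P z))\<bar> < 1"
      using abs_Re_le_cmod le_less_trans by blast
    ultimately show "Re (poly p z) \<ge> M"
      unfolding T_def minus_complex.sel by linarith
  qed
qed

section \<open>Lengths of curves crossing a labyrinth\<close>

text \<open>The curves are merely continuous, so length is handled by inscribed polygons, and as a
  relation instead of a supremum: pieces concatenate, and infinite length means that
  \<open>l\<close> is unbounded. Admitting \<open>s = t\<close> with length 0 spares strictness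
  conditions when gluing.\<close>

inductive polygon_length :: "(real \<Rightarrow> 'a::real_normed_vector) \<Rightarrow> real \<Rightarrow> real \<Rightarrow> real \<Rightarrow> bool"
  for f :: "real \<Rightarrow> 'a" where
  point: "polygon_length f s s 0"
| extend: "polygon_length f s t l \<Longrightarrow> t < u \<Longrightarrow> polygon_length f s u (l + norm (f u - f t))"

lemma polygon_length_trans:
  assumes "polygon_length f t u m" "polygon_length f s t l"
  shows "polygon_length f s u (l + m)"
  using assms
proof (induction rule: polygon_length.induct)
  case (extend t t' m' u)
  then show ?case using polygon_length.extend[of f s t' "l + m'" u] by (simp add: add.assoc)
qed auto

lemma polygon_length_segment:
  assumes "s \<le> t"
  shows "polygon_length f s t (norm (f t - f s))"
proof (cases "s = t")
  case False
  then show ?thesis using polygon_length.extend[OF polygon_length.point[of f s], of t] assms by simp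
qed (simp add: polygon_length.point)

lemma polygon_length_partition:
  assumes "polygon_length f s t l"
  obtains n and ts :: "nat \<Rightarrow> real" where "ts 0 = s" "ts n = t" "\<And>i. i < n \<Longrightarrow> ts i < ts (Suc i)"
    "(\<Sum>i<n. norm (f (ts (Suc i)) - f (ts i))) = l"
proof -
  have "\<exists>n ts. ts 0 = s \<and> ts n = t \<and> (\<forall>i<n. ts i < ts (Suc i)) \<and>
      (\<Sum>i<n. norm (f (ts (Suc i)) - f (ts i))) = l"
    using assms
  proof (induction rule: polygon_length.induct)
    case (point s)
    show ?case by (intro exI[of _ "0::nat"] exI[of _ "\<lambda>_. s"]) simp
  next
    case (extend s t l u)
    then obtain n ts where n: "ts 0 = s" "ts n = t" "\<forall>i<n. ts i < ts (Suc i)"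
      "(\<Sum>i<n. norm (f (ts (Suc i)) - f (ts i))) = l" by blast
    define ts' where "ts' = ts(Suc n := u)"
    have "ts' 0 = s" "ts' (Suc n) = u" "\<forall>i<Suc n. ts' i < ts' (Suc i)"
      using n extend.hyps by (auto simp: ts'_def less_Suc_eq)
    moreover have "(\<Sum>i<Suc n. norm (f (ts' (Suc i)) - f (ts' i))) = l + norm (f u - f t)"
      using n by (auto simp: ts'_def)
    ultimately show ?case by blast
  qed
  then show ?thesis using that by blast
qed

text \<open>Since \<open>\<gamma>\<close> is only continuous, its length is not an integral of
  \<open>norm (D h)\<close>. Near each time \<open>x\<close> the derivative at the single point
  \<open>\<gamma> x\<close> controls the chords starting there, once \<open>m\<close> is lowered to
  \<open>k\<close> to absorb the remainder; Bolzano's bisection principle glues these local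
  estimates.\<close>

lemma polygon_length_lower_bound:
  fixes Y :: "complex \<Rightarrow> 'a::real_normed_vector"
  assumes st: "s \<le> t" and \<gamma>: "continuous_on {s..t} \<gamma>" and k: "k < m"
    and D: "\<And>x. x \<in> {s..t} \<Longrightarrow>
      \<exists>D. (Y has_derivative D) (at (\<gamma> x)) \<and> (\<forall>h. m * norm h \<le> norm (D h))"
  shows "\<exists>l \<ge> k * norm (\<gamma> t - \<gamma> s). polygon_length (Y \<circ> \<gamma>) s t l"
proof -
  define P where "P = (\<lambda>a b. s \<le> a \<and> a \<le> b \<and> b \<le> t \<longrightarrow>
    (\<exists>l \<ge> k * norm (\<gamma> b - \<gamma> a). polygon_length (Y \<circ> \<gamma>) a b l))"
  have tri: "k * norm (\<gamma> c - \<gamma> a) \<le> l + l'"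
    if "k * norm (\<gamma> b - \<gamma> a) \<le> l" "k * norm (\<gamma> c - \<gamma> b) \<le> l'" "0 \<le> l" "0 \<le> l'" for a b c l l'
  proof (cases "k \<ge> 0")
    case True
    have "norm (\<gamma> c - \<gamma> a) \<le> norm (\<gamma> b - \<gamma> a) + norm (\<gamma> c - \<gamma> b)"
      using norm_triangle_ineq[of "\<gamma> b - \<gamma> a" "\<gamma> c - \<gamma> b"] by simp
    then have "k * norm (\<gamma> c - \<gamma> a) \<le> k * (norm (\<gamma> b - \<gamma> a) + norm (\<gamma> c - \<gamma> b))"
      using True by (rule mult_left_mono)
    then show ?thesis using that by (simp add: distrib_left)
  next
    case False
    then have "k * norm (\<gamma> c - \<gamma> a) \<le> 0" by (simp add: mult_nonpos_nonneg)
    then show ?thesis using that by linarith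
  qed
  have nonneg: "0 \<le> l" if "polygon_length f a b l" for f :: "real \<Rightarrow> 'a" and a b l
    using that by (induction rule: polygon_length.induct) auto
  have "P s t" using st
  proof (induction rule: Bolzano)
    case (trans a b c)
    show ?case unfolding P_def
    proof
      assume "s \<le> a \<and> a \<le> c \<and> c \<le> t"
      then obtain l l' where "k * norm (\<gamma> b - \<gamma> a) \<le> l" "polygon_length (Y \<circ> \<gamma>) a b l"
        "k * norm (\<gamma> c - \<gamma> b) \<le> l'" "polygon_length (Y \<circ> \<gamma>) b c l'"
        using trans unfolding P_def by (meson order_trans)
      then show "\<exists>l \<ge> k * norm (\<gamma> c - \<gamma> a). polygon_length (Y \<circ> \<gamma>) a c l"
        using tri nonneg polygon_length_trans by blast
    qed
  next
    case (local x)
    then obtain D where D: "(Y has_derivative D) (at (\<gamma> x))" "\<forall>h. m * norm h \<le> norm (D h)"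
      using assms(4)[of x] by auto
    have "m - k > 0" using k by simp
    then obtain d where d: "d > 0" "\<And>w. norm (w - \<gamma> x) < d \<Longrightarrow>
        norm (Y w - Y (\<gamma> x) - D (w - \<gamma> x)) \<le> (m - k) * norm (w - \<gamma> x)"
      using D(1) unfolding has_derivative_at_alt by meson
    have Y: "k * norm (w - \<gamma> x) \<le> norm (Y w - Y (\<gamma> x))" if "norm (w - \<gamma> x) < d" for w
    proof -
      have "m * norm (w - \<gamma> x) \<le> norm (D (w - \<gamma> x))" using D(2) by blast
      also have "\<dots> \<le> norm (Y w - Y (\<gamma> x)) + norm (Y w - Y (\<gamma> x) - D (w - \<gamma> x))"
        by (metis norm_triangle_sub norm_minus_commute add.commute)
      finally show ?thesis using d(2)[OF that] by (simp add: algebra_simps)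
    qed
    obtain \<delta> where \<delta>: "\<delta> > 0" "\<And>y. y \<in> {s..t} \<Longrightarrow> dist y x < \<delta> \<Longrightarrow> dist (\<gamma> y) (\<gamma> x) < d"
      using \<gamma> d(1) local unfolding continuous_on_iff by (metis atLeastAtMost_iff)
    \<comment> \<open>Only chords from \<open>\<gamma> x\<close> are controlled, so the local
      polygon gets a vertex at \<open>x\<close>.\<close>
    have "P a b" if ab: "a \<le> x \<and> x \<le> b \<and> b - a < \<delta>" for a b
      unfolding P_def
    proof
      assume in_st: "s \<le> a \<and> a \<le> b \<and> b \<le> t"
      have "dist a x < \<delta>" "dist b x < \<delta>" "a \<in> {s..t}" "b \<in> {s..t}"
        using ab in_st by (auto simp: dist_real_def)
      then have "norm (\<gamma> a - \<gamma> x) < d" "norm (\<gamma> b - \<gamma> x) < d"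
        using \<delta>(2) by (auto simp: dist_norm)
      then have "k * norm (\<gamma> x - \<gamma> a) \<le> norm ((Y \<circ> \<gamma>) x - (Y \<circ> \<gamma>) a)"
        "k * norm (\<gamma> b - \<gamma> x) \<le> norm ((Y \<circ> \<gamma>) b - (Y \<circ> \<gamma>) x)"
        using Y by (auto simp: norm_minus_commute)
      then show "\<exists>l \<ge> k * norm (\<gamma> b - \<gamma> a). polygon_length (Y \<circ> \<gamma>) a b l"
        using tri[of x a "norm ((Y \<circ> \<gamma>) x - (Y \<circ> \<gamma>) a)" b "norm ((Y \<circ> \<gamma>) b - (Y \<circ> \<gamma>) x)"]
          polygon_length_trans[OF polygon_length_segment polygon_length_segment, of x b a "Y \<circ> \<gamma>"] ab
        by (meson norm_ge_zero)
    qed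
    then show ?case using \<delta>(1) by blast
  qed
  then show ?thesis using st by (simp add: P_def)
qed

text \<open>\<open>t'\<close> is the first time at level \<open>b\<close> and \<open>s'\<close> the
  last time before it at level \<open>a\<close>. By the intermediate value theorem, leaving the
  strip in between would produce an earlier \<open>b\<close> or a later \<open>a\<close>.\<close>

lemma crossing_interval:
  fixes f :: "real \<Rightarrow> real"
  assumes "s \<le> t" "continuous_on {s..t} f" "f s \<le> a" "b \<le> f t" "a < b"
  obtains s' t' where "s \<le> s'" "s' < t'" "t' \<le> t" "f s' = a" "f t' = b"
    "\<And>x. x \<in> {s'..t'} \<Longrightarrow> a \<le> f x \<and> f x \<le> b"
proof -
  have compact_level: "compact ({u..v} \<inter> f -` {c})" if "s \<le> u" "v \<le> t" for u v c
  proof -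
    have "continuous_on {u..v} f" using assms(2) that continuous_on_subset by fastforce
    then have "closed ({u..v} \<inter> f -` {c})" by (intro continuous_closed_preimage) auto
    then show ?thesis by (metis closed_Int_compact compact_Icc inf_left_idem inf.commute)
  qed
  have level: "\<exists>x\<in>{u..v}. f x = c" if "s \<le> u" "u \<le> v" "v \<le> t" "f u \<le> c" "c \<le> f v" for u v c
    using IVT'[of f u c v] that continuous_on_subset[OF assms(2), of "{u..v}"] by force
  obtain t' where t': "t' \<in> {s..t}" "f t' = b" "\<And>y. y \<in> {s..t} \<Longrightarrow> f y = b \<Longrightarrow> t' \<le> y"
  proof -
    have "{s..t} \<inter> f -` {b} \<noteq> {}" using level[of s t b] assms by auto
    then show ?thesis using compact_attains_inf[OF compact_level[of s t b]] that by blast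
  qed
  obtain s' where s': "s' \<in> {s..t'}" "f s' = a" "\<And>y. y \<in> {s..t'} \<Longrightarrow> f y = a \<Longrightarrow> y \<le> s'"
  proof -
    have "{s..t'} \<inter> f -` {a} \<noteq> {}" using level[of s t' a] assms t' by auto
    moreover have "t' \<le> t" using t' by simp
    ultimately show ?thesis using compact_attains_sup[OF compact_level[of s t' a]] that by blast
  qed
  have "s' \<noteq> t'" using s' t' assms by auto
  moreover have "a \<le> f x \<and> f x \<le> b" if x: "x \<in> {s'..t'}" for x
  proof (rule ccontr)
    assume "\<not> (a \<le> f x \<and> f x \<le> b)"
    then consider "f x < a" | "b < f x" by linarith
    then show False
    proof cases
      case 1
      then obtain y where y: "y \<in> {x..t'}" "f y = a"
        using level[of x t' a] x s' t' assms by auto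
      then have "y \<le> s'" using s' x by auto
      then have "x = s'" using x y by auto
      then show False using 1 s' by simp
    next
      case 2
      then obtain y where y: "y \<in> {s..x}" "f y = b"
        using level[of s x b] x s' t' assms by auto
      then have "t' \<le> y" using t' x by auto
      then have "x = t'" using x y by auto
      then show False using 2 t' by simp
    qed
  qed
  ultimately show ?thesis using that[of s' t'] s' t' by auto
qed

text \<open>Slit rings whose gaps lie alternately on the right and on the left, so that a curve through
  two consecutive gaps moves a Euclidean distance of at least \<open>1 / 2\<close>.\<close>

definition layer :: "real \<Rightarrow> real \<Rightarrow> nat \<Rightarrow> complex set" where
  "layer a d i = {z. a + (2 * real i + 1) * d \<le> norm z \<and> norm z \<le> a + (2 * real i + 2) * d \<and>
     (-1) ^ i * Re z \<le> 1 / 4}"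

text \<open>Crossing a ring inside its layer costs at least 1, as the thickness is \<open>d\<close>
  and the chords are stretched by \<open>1 / d\<close>. Otherwise the curve meets the gap side of
  every ring in turn, and each of the \<open>N - 1\<close> changes of side costs
  \<open>(m / 2) * (1 / 2)\<close>, in total \<open>(N - 1) * m / 4 \<ge> 1\<close>. The factors
  \<open>2 / d\<close> and \<open>m\<close> are halved because the polygon estimate needs a strictly
  smaller constant.\<close>

lemma annulus_crossing_length:
  fixes Y :: "complex \<Rightarrow> 'a::real_normed_vector" and a d m :: real and N :: nat
  assumes st: "s \<le> t" and \<gamma>: "continuous_on {s..t} \<gamma>"
    and ends: "norm (\<gamma> s) \<le> a" "a + 2 * real N * d \<le> norm (\<gamma> t)"
    and d: "d > 0" and m: "m > 0" and N: "(real N - 1) * m \<ge> 4"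
    and annulus: "\<And>z. a \<le> norm z \<Longrightarrow> norm z \<le> a + 2 * real N * d \<Longrightarrow>
      \<exists>D. (Y has_derivative D) (at z) \<and> (\<forall>h. m * norm h \<le> norm (D h))"
    and layers: "\<And>i z. i < N \<Longrightarrow> z \<in> layer a d i \<Longrightarrow>
      \<exists>D. (Y has_derivative D) (at z) \<and> (\<forall>h. 2 / d * norm h \<le> norm (D h))"
  shows "\<exists>l\<ge>1. polygon_length (Y \<circ> \<gamma>) s t l"
proof (rule ccontr)
  assume short: "\<not> ?thesis"
  have cont: "continuous_on {u..v} \<gamma>" if "s \<le> u" "v \<le> t" for u v
    using \<gamma> that continuous_on_subset by fastforce
  have contn: "continuous_on {u..v} (\<lambda>x. norm (\<gamma> x))" if "s \<le> u" "v \<le> t" for u v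
    using cont[OF that] by (rule continuous_on_norm)
  \<comment> \<open>A polygon over a subinterval extends to \<open>s\<close> and \<open>t\<close> by
    two chords, so length 1 found anywhere is enough for the contradiction.\<close>
  have short': "l < 1" if "polygon_length (Y \<circ> \<gamma>) u v l" "s \<le> u" "v \<le> t" for u v l
  proof (rule ccontr)
    assume "\<not> l < 1"
    have "polygon_length (Y \<circ> \<gamma>) s t
        (norm ((Y \<circ> \<gamma>) u - (Y \<circ> \<gamma>) s) + l + norm ((Y \<circ> \<gamma>) t - (Y \<circ> \<gamma>) v))"
      using polygon_length_trans[OF polygon_length_segment[OF that(3)]
          polygon_length_trans[OF that(1) polygon_length_segment[OF that(2)]]] .
    moreover have "norm ((Y \<circ> \<gamma>) u - (Y \<circ> \<gamma>) s) + l + norm ((Y \<circ> \<gamma>) t - (Y \<circ> \<gamma>) v) \<ge> 1"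
      using \<open>\<not> l < 1\<close> norm_ge_zero[of "(Y \<circ> \<gamma>) u - (Y \<circ> \<gamma>) s"]
        norm_ge_zero[of "(Y \<circ> \<gamma>) t - (Y \<circ> \<gamma>) v"] by linarith
    ultimately show False using short by blast
  qed
  have N1: "N \<ge> 2"
  proof (rule ccontr)
    assume "\<not> 2 \<le> N"
    then have "(real N - 1) * m \<le> 0" using m by (intro mult_nonpos_nonneg) auto
    then show False using N by linarith
  qed
  have "a < a + 2 * real N * d" using N1 d by simp
  then obtain s' t' where s't': "s \<le> s'" "s' < t'" "t' \<le> t" "norm (\<gamma> s') = a" "norm (\<gamma> t') = a + 2 * real N * d"
    and inside: "\<And>x. x \<in> {s'..t'} \<Longrightarrow> a \<le> norm (\<gamma> x) \<and> norm (\<gamma> x) \<le> a + 2 * real N * d"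
    using crossing_interval[OF st contn[of s t] ends] by auto
  \<comment> \<open>The radius bound keeps \<open>\<gamma> \<tau>\<close> below the inner edge of
    ring \<open>k + 1\<close>, so the search for the next gap can start at \<open>\<tau>\<close>. If
    there were no such time, ring \<open>k\<close> would be crossed entirely within its
    layer.\<close>
  have gap: "\<exists>\<tau>\<in>{u..t'}. norm (\<gamma> \<tau>) \<le> a + (2 * real k + 2) * d \<and> (-1) ^ k * Re (\<gamma> \<tau>) > 1 / 4"
    if u: "u \<in> {s'..t'}" "norm (\<gamma> u) \<le> a + (2 * real k + 1) * d" and k: "k < N" for u k
  proof (rule ccontr)
    assume no: "\<not> ?thesis"
    have "(2 * real k + 2) * d \<le> 2 * real N * d"
      using k d by (intro mult_right_mono) auto
    then have kt: "a + (2 * real k + 2) * d \<le> norm (\<gamma> t')" using s't' by linarith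
    have kd: "a + (2 * real k + 1) * d < a + (2 * real k + 2) * d" using d by simp
    have "u \<le> t'" and "continuous_on {u..t'} (\<lambda>x. norm (\<gamma> x))"
      using u s't' contn[of u t'] by auto
    then obtain p q where pq: "u \<le> p" "p < q" "q \<le> t'"
      "norm (\<gamma> p) = a + (2 * real k + 1) * d" "norm (\<gamma> q) = a + (2 * real k + 2) * d"
      and pq': "\<And>x. x \<in> {p..q} \<Longrightarrow> a + (2 * real k + 1) * d \<le> norm (\<gamma> x) \<and> norm (\<gamma> x) \<le> a + (2 * real k + 2) * d"
      by (rule crossing_interval[where f = "\<lambda>x. norm (\<gamma> x)", OF _ _ u(2) kt kd]) blast
    have "\<gamma> x \<in> layer a d k" if "x \<in> {p..q}" for x
    proof -
      have "x \<in> {u..t'}" using that pq by auto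
      then have "\<not> (-1) ^ k * Re (\<gamma> x) > 1 / 4" using no pq'[OF that] by blast
      then show ?thesis using pq'[OF that] by (simp add: layer_def)
    qed
    then have "\<exists>l \<ge> (1 / d) * norm (\<gamma> q - \<gamma> p). polygon_length (Y \<circ> \<gamma>) p q l"
      using pq u s't' d layers[OF k]
      by (intro polygon_length_lower_bound[where m = "2 / d"] cont) (auto simp: divide_strict_right_mono)
    then obtain l where l: "l \<ge> (1 / d) * norm (\<gamma> q - \<gamma> p)" "polygon_length (Y \<circ> \<gamma>) p q l"
      by blast
    have "d \<le> norm (\<gamma> q - \<gamma> p)"
      using norm_triangle_ineq2[of "\<gamma> q" "\<gamma> p"] pq by (simp add: algebra_simps)
    then have "1 \<le> (1 / d) * norm (\<gamma> q - \<gamma> p)" using d by simp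
    moreover have "l < 1" using short'[OF l(2)] pq u s't' by auto
    ultimately show False using l(1) by linarith
  qed
  have "\<exists>\<tau>\<in>{s'..t'}. norm (\<gamma> \<tau>) \<le> a + (2 * real k + 2) * d \<and> (-1) ^ k * Re (\<gamma> \<tau>) > 1 / 4 \<and>
      (\<exists>l \<ge> real k * m / 4. polygon_length (Y \<circ> \<gamma>) s' \<tau> l)" if "k < N" for k
    using that
  proof (induction k)
    case 0
    have "\<exists>\<tau>\<in>{s'..t'}. norm (\<gamma> \<tau>) \<le> a + (2 * real 0 + 2) * d \<and> (-1) ^ (0::nat) * Re (\<gamma> \<tau>) > 1 / 4"
      by (rule gap) (use s't' d 0 in auto)
    then obtain \<tau> where "\<tau> \<in> {s'..t'}" "norm (\<gamma> \<tau>) \<le> a + (2 * real 0 + 2) * d"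
      "(-1) ^ (0::nat) * Re (\<gamma> \<tau>) > 1 / 4" by blast
    moreover have "\<exists>l \<ge> real 0 * m / 4. polygon_length (Y \<circ> \<gamma>) s' \<tau> l"
      using polygon_length_segment[of s' \<tau> "Y \<circ> \<gamma>"] \<open>\<tau> \<in> {s'..t'}\<close>
      by (intro exI[of _ "norm ((Y \<circ> \<gamma>) \<tau> - (Y \<circ> \<gamma>) s')"]) simp
    ultimately show ?case by blast
  next
    case (Suc k)
    then obtain \<tau> l where \<tau>: "\<tau> \<in> {s'..t'}" "norm (\<gamma> \<tau>) \<le> a + (2 * real k + 2) * d"
      "(-1) ^ k * Re (\<gamma> \<tau>) > 1 / 4" and l: "l \<ge> real k * m / 4" "polygon_length (Y \<circ> \<gamma>) s' \<tau> l"
      using Suc_lessD by blast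
    have "norm (\<gamma> \<tau>) \<le> a + (2 * real (Suc k) + 1) * d" using \<tau>(2) d by (simp add: algebra_simps)
    then obtain \<tau>' where \<tau>': "\<tau>' \<in> {\<tau>..t'}" "norm (\<gamma> \<tau>') \<le> a + (2 * real (Suc k) + 2) * d"
      "(-1) ^ Suc k * Re (\<gamma> \<tau>') > 1 / 4"
      using gap[OF \<tau>(1), of "Suc k"] Suc.prems by blast
    have "\<exists>l' \<ge> (m / 2) * norm (\<gamma> \<tau>' - \<gamma> \<tau>). polygon_length (Y \<circ> \<gamma>) \<tau> \<tau>' l'"
      using \<tau> \<tau>' s't' m inside
      by (intro polygon_length_lower_bound[where m = m] cont annulus) auto
    then obtain l' where l': "l' \<ge> (m / 2) * norm (\<gamma> \<tau>' - \<gamma> \<tau>)"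
      "polygon_length (Y \<circ> \<gamma>) \<tau> \<tau>' l'" by blast
    have "1 / 2 \<le> \<bar>Re (\<gamma> \<tau>' - \<gamma> \<tau>)\<bar>"
      using \<tau>(3) \<tau>'(3) by (cases "even k") auto
    also have "\<dots> \<le> norm (\<gamma> \<tau>' - \<gamma> \<tau>)" by (rule abs_Re_le_cmod)
    finally have "(m / 2) * (1 / 2) \<le> (m / 2) * norm (\<gamma> \<tau>' - \<gamma> \<tau>)"
      using m by (intro mult_left_mono) auto
    then have "l + l' \<ge> real (Suc k) * m / 4" using l(1) l'(1) by (simp add: algebra_simps)
    moreover have "\<tau>' \<in> {s'..t'}" using \<tau>(1) \<tau>'(1) by auto
    ultimately show ?case
      using \<tau>'(2,3) polygon_length_trans[OF l'(2) l(2)] by blast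
  qed
  from this[of "N - 1"] have "\<exists>\<tau>\<in>{s'..t'}. \<exists>l \<ge> real (N - 1) * m / 4. polygon_length (Y \<circ> \<gamma>) s' \<tau> l"
    using N1 by fastforce
  then obtain \<tau> l where "\<tau> \<in> {s'..t'}" "l \<ge> real (N - 1) * m / 4"
    "polygon_length (Y \<circ> \<gamma>) s' \<tau> l" by blast
  moreover have "real (N - 1) * m / 4 \<ge> 1" using N N1 by (simp add: of_nat_diff)
  moreover have "l < 1" using calculation short'[of s' \<tau> l] s't' by auto
  ultimately show False by linarith
qed

section \<open>A holomorphic function large on the labyrinths\<close>

text \<open>Rings are added from the inside outwards. The new term is below 1 in modulus on the
  earlier rings, hence the induction hypothesis at \<open>T + 1\<close>, and on the new ring it
  outweighs the bound \<open>M\<close> of the old polynomial. The free annulus of width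
  \<open>d\<close> below each ring is where the poles of the model function lie;
  \<open>a \<ge> 1 / 4\<close> keeps the slit level \<open>1 / 4\<close> below the inner
  radius.\<close>

lemma labyrinth_polynomial:
  fixes a d e T :: real and N :: nat
  assumes "a \<ge> 1 / 4" "d > 0" "e > 0"
  shows "\<exists>p. (\<forall>z. norm z \<le> a \<longrightarrow> norm (poly p z) < e) \<and>
    (\<forall>i<N. \<forall>z\<in>layer a d i. T \<le> Re (poly p z))"
  using assms(3)
proof (induction N arbitrary: e T)
  case 0
  then show ?case by (intro exI[of _ 0]) auto
next
  case (Suc N)
  obtain p where p: "\<And>z. norm z \<le> a \<Longrightarrow> norm (poly p z) < e / 2"
    "\<And>i z. i < N \<Longrightarrow> z \<in> layer a d i \<Longrightarrow> T + 1 \<le> Re (poly p z)"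
    using Suc.IH[of "e / 2" "T + 1"] Suc.prems by auto
  obtain M where M: "\<And>z. z \<in> cball 0 (a + (2 * real N + 2) * d) \<Longrightarrow> norm (poly p z) \<le> M"
    using poly_bounded_compact[OF compact_cball] by blast
  have pos: "0 < a + 2 * real N * d" using assms(1,2) by (simp add: add_pos_nonneg)
  have c: "1 / 4 \<le> a + 2 * real N * d" using assms(1,2) by (simp add: add_increasing2)
  have lt: "a + 2 * real N * d < a + (2 * real N + 1) * d"
    "a + (2 * real N + 1) * d \<le> a + (2 * real N + 2) * d"
    using assms(2) by (auto simp: distrib_right)
  have s: "(-1::real) ^ N = 1 \<or> (-1::real) ^ N = -1" by (cases "even N") auto
  have e: "min (e / 2) 1 > 0" using Suc.prems by simp
  obtain q where q: "\<And>z. norm z \<le> a + 2 * real N * d \<Longrightarrow> norm (poly q z) < min (e / 2) 1"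
    "\<And>z. a + (2 * real N + 1) * d \<le> norm z \<Longrightarrow> norm z \<le> a + (2 * real N + 2) * d \<Longrightarrow>
      (-1) ^ N * Re z \<le> 1 / 4 \<Longrightarrow> T + M \<le> Re (poly q z)"
    using layer_polynomial[OF pos lt c s e] by blast
  show ?case
  proof (intro exI[of _ "p + q"] conjI allI impI ballI)
    fix z :: complex assume z: "norm z \<le> a"
    then have "norm z \<le> a + 2 * real N * d" using assms(2) by (simp add: add_increasing2)
    then show "norm (poly (p + q) z) < e"
      using p(1)[OF z] q(1)[of z] norm_triangle_ineq[of "poly p z" "poly q z"] by simp
  next
    fix i z assume i: "i < Suc N" and z: "z \<in> layer a d i"
    show "T \<le> Re (poly (p + q) z)"
    proof (cases "i = N")
      case True
      then have "T + M \<le> Re (poly q z)" using z q(2) by (simp add: layer_def)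
      moreover have "norm (poly p z) \<le> M" using z True by (intro M) (simp add: layer_def)
      then have "- M \<le> Re (poly p z)" using abs_Re_le_cmod[of "poly p z"] by linarith
      ultimately show ?thesis by simp
    next
      case False
      then have "i < N" using i by simp
      have "(2 * real i + 2) * d \<le> 2 * real N * d"
        using \<open>i < N\<close> assms(2) by (intro mult_right_mono) auto
      then have "norm z \<le> a + 2 * real N * d" using z unfolding layer_def by auto
      then have "norm (poly q z) < 1" using q(1) by fastforce
      then have "- 1 \<le> Re (poly q z)" using abs_Re_le_cmod[of "poly q z"] by linarith
      then show ?thesis using p(2)[OF \<open>i < N\<close> z] by simp
    qed
  qed
qed

text \<open>A telescoping series of labyrinth polynomials. The steps after \<open>f (Suc n)\<close>
  change the function by at most \<open>\<delta> / 2^(n+1) \<le> 1\<close> on the disc containing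
  the \<open>n\<close>-th labyrinth, which is why \<open>T n + 1\<close> is aimed at. Starting from
  \<open>f 0 = 0\<close> makes the limit small on the first disc.\<close>

lemma holomorphic_large_on_layers:
  fixes a d T :: "nat \<Rightarrow> real" and N :: "nat \<Rightarrow> nat"
  assumes S: "open S" and a: "a 0 \<ge> 1 / 4" and d: "\<And>n. d n > 0" and e: "e > 0"
    and next_a: "\<And>n. a n + 2 * real (N n) * d n \<le> a (Suc n)"
    and exhaust: "\<And>z. z \<in> S \<Longrightarrow> \<exists>n. norm z < a n"
  obtains h where "h holomorphic_on S" "\<And>z. norm z \<le> a 0 \<Longrightarrow> norm (h z) < e"
    "\<And>n i z. i < N n \<Longrightarrow> z \<in> layer (a n) (d n) i \<Longrightarrow> T n \<le> Re (h z)"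
proof -
  define \<delta> where "\<delta> = min (e / 2) 1"
  have \<delta>: "0 < \<delta>" "\<delta> \<le> 1" "\<delta> < e" using e by (auto simp: \<delta>_def)
  have "a n \<le> a (Suc n)" for n
    using next_a[of n] d[of n] by (smt (verit) mult_nonneg_nonneg of_nat_0_le_iff)
  then have "mono a" by (rule incseq_SucI)
  have a4: "a n \<ge> 1 / 4" for n using a \<open>mono a\<close> by (meson le0 monoD order_trans)
  \<comment> \<open>The guarded clause \<open>n = 0 \<longrightarrow> f n = 0\<close> fits the
    starting value into the shape required by dependent choice.\<close>
  have "\<exists>f. \<forall>n. (n = 0 \<longrightarrow> f n = 0) \<and>
    ((\<forall>z. norm z \<le> a n \<longrightarrow> norm (poly (f (Suc n)) z - poly (f n) z) < \<delta> / 2 ^ Suc n) \<and>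
     (\<forall>i<N n. \<forall>z\<in>layer (a n) (d n) i. T n + 1 \<le> Re (poly (f (Suc n)) z)))"
  proof (rule dependent_nat_choice)
    show "\<exists>q::complex poly. (0::nat) = 0 \<longrightarrow> q = 0" by blast
    fix q :: "complex poly" and n :: nat
    obtain M where M: "\<And>z. z \<in> cball 0 (a (Suc n)) \<Longrightarrow> norm (poly q z) \<le> M"
      using poly_bounded_compact[OF compact_cball] by blast
    have "\<delta> / 2 ^ Suc n > 0" using \<delta> by simp
    then obtain p where p: "\<And>z. norm z \<le> a n \<Longrightarrow> norm (poly p z) < \<delta> / 2 ^ Suc n"
      "\<And>i z. i < N n \<Longrightarrow> z \<in> layer (a n) (d n) i \<Longrightarrow> T n + 1 + M \<le> Re (poly p z)"
      using labyrinth_polynomial[OF a4 d, of "\<delta> / 2 ^ Suc n" n "N n" n "T n + 1 + M"] by blast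
    have "T n + 1 \<le> Re (poly (q + p) z)" if i: "i < N n" and z: "z \<in> layer (a n) (d n) i" for i z
    proof -
      have "(2 * real i + 2) * d n \<le> 2 * real (N n) * d n"
        using i d[of n] by (intro mult_right_mono) auto
      then have "norm z \<le> a (Suc n)" using z next_a[of n] unfolding layer_def by auto
      then have "norm (poly q z) \<le> M" by (intro M) simp
      then have "- M \<le> Re (poly q z)" using abs_Re_le_cmod[of "poly q z"] by linarith
      then show ?thesis using p(2)[OF i z] by simp
    qed
    then show "\<exists>q'. (Suc n = 0 \<longrightarrow> q' = 0) \<and>
      ((\<forall>z. norm z \<le> a n \<longrightarrow> norm (poly q' z - poly q z) < \<delta> / 2 ^ Suc n) \<and>
       (\<forall>i<N n. \<forall>z\<in>layer (a n) (d n) i. T n + 1 \<le> Re (poly q' z)))"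
      using p(1) by (intro exI[of _ "q + p"]) auto
  qed
  then obtain f where f: "\<And>n. (n = 0 \<longrightarrow> f n = 0) \<and>
    ((\<forall>z. norm z \<le> a n \<longrightarrow> norm (poly (f (Suc n)) z - poly (f n) z) < \<delta> / 2 ^ Suc n) \<and>
     (\<forall>i<N n. \<forall>z\<in>layer (a n) (d n) i. T n + 1 \<le> Re (poly (f (Suc n)) z)))"
    by (elim exE) (rule that, erule spec)
  have f0: "f 0 = 0" using f[of 0] by simp
  have step: "norm (poly (f (Suc n)) z - poly (f n) z) < \<delta> / 2 ^ Suc n" if "norm z \<le> a n" for n z
    using f[of n] that by blast
  have large: "T n + 1 \<le> Re (poly (f (Suc n)) z)" if "i < N n" "z \<in> layer (a n) (d n) i" for n i z
    using f[of n] that by blast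
  define h where "h = (\<lambda>z. lim (\<lambda>n. poly (f n) z))"
  have close: "norm (h z - poly (f n) z) \<le> \<delta> / 2 ^ n" if z: "norm z \<le> a n" for n z
  proof -
    define g where "g = (\<lambda>k. poly (f (Suc (k + n))) z - poly (f (k + n)) z)"
    have geo: "(\<lambda>k. \<delta> / 2 ^ Suc n * (1 / 2) ^ k) sums (\<delta> / 2 ^ Suc n * 2)"
      using geometric_sums[of "1 / 2 :: real"] by (intro sums_mult) simp
    have le: "norm (g k) \<le> \<delta> / 2 ^ Suc n * (1 / 2) ^ k" for k
    proof -
      have "norm z \<le> a (k + n)" using z \<open>mono a\<close> by (meson le_add2 monoD order_trans)
      then show ?thesis
        using step[of z "k + n"] by (simp add: g_def power_add power_one_over field_simps)
    qed
    have "summable g"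
      using le sums_summable[OF geo] by (rule summable_comparison_test'[rotated])
    moreover have "(\<Sum>k<m. g k) = poly (f (m + n)) z - poly (f n) z" for m
      unfolding g_def by (induction m) auto
    ultimately have "(\<lambda>m. poly (f (m + n)) z - poly (f n) z) \<longlonglongrightarrow> suminf g"
      using summable_LIMSEQ[of g] by simp
    then have "(\<lambda>m. (poly (f (m + n)) z - poly (f n) z) + poly (f n) z) \<longlonglongrightarrow> suminf g + poly (f n) z"
      by (intro tendsto_intros)
    then have "(\<lambda>m. poly (f m) z) \<longlonglongrightarrow> suminf g + poly (f n) z"
      by (simp add: LIMSEQ_offset)
    then have "h z - poly (f n) z = suminf g" by (simp add: h_def limI)
    also have "norm \<dots> \<le> (\<Sum>k. \<delta> / 2 ^ Suc n * (1 / 2) ^ k)"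
      using le sums_summable[OF geo] by (rule norm_suminf_le)
    also have "\<dots> = \<delta> / 2 ^ n" using sums_unique[OF geo] by simp
    finally show ?thesis .
  qed
  show ?thesis
  proof
    show "h holomorphic_on S"
    proof (rule holomorphic_uniform_sequence[OF S])
      show "(\<lambda>z. poly (f n) z) holomorphic_on S" for n by (intro holomorphic_intros)
      fix x assume "x \<in> S"
      then obtain n where n: "norm x < a n" using exhaust by blast
      have "open (S \<inter> ball 0 (a n))" "x \<in> S \<inter> ball 0 (a n)" using S \<open>x \<in> S\<close> n by auto
      then obtain r where r: "r > 0" "cball x r \<subseteq> S \<inter> ball 0 (a n)"
        using open_contains_cball by blast
      have "uniform_limit (cball x r) (\<lambda>n z. poly (f n) z) h sequentially"
      proof (rule uniform_limitI)
        fix \<eta> :: real assume "\<eta> > 0"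
        have "(\<lambda>m. \<delta> / 2 ^ m) \<longlonglongrightarrow> 0"
          by (rule LIMSEQ_divide_realpow_zero) simp
        then have "\<forall>\<^sub>F m in sequentially. \<delta> / 2 ^ m < \<eta>"
          using \<open>\<eta> > 0\<close> by (rule order_tendstoD)
        then show "\<forall>\<^sub>F m in sequentially. \<forall>z\<in>cball x r. dist (poly (f m) z) (h z) < \<eta>"
          using eventually_ge_at_top[of n]
        proof eventually_elim
          case (elim m)
          have "dist (poly (f m) z) (h z) < \<eta>" if "z \<in> cball x r" for z
          proof -
            have "norm z < a n" using r(2) that by (auto simp: subset_iff)
            then have "norm z \<le> a m" using \<open>mono a\<close> elim(2) by (meson less_imp_le monoD order_trans)
            then show ?thesis using close[of z m] elim(1) by (simp add: dist_norm norm_minus_commute)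
          qed
          then show ?case by blast
        qed
      qed
      then show "\<exists>r>0. cball x r \<subseteq> S \<and> uniform_limit (cball x r) (\<lambda>n z. poly (f n) z) h sequentially"
        using r by blast
    qed
    show "norm (h z) < e" if "norm z \<le> a 0" for z
      using close[OF that] f0 \<delta> by simp
    fix n i z assume i: "i < N n" and z: "z \<in> layer (a n) (d n) i"
    have "(2 * real i + 2) * d n \<le> 2 * real (N n) * d n"
      using i d[of n] by (intro mult_right_mono) auto
    then have "norm z \<le> a (Suc n)" using z next_a[of n] unfolding layer_def by auto
    then have "norm (h z - poly (f (Suc n)) z) \<le> \<delta> / 2 ^ Suc n" by (rule close)
    also have "\<dots> \<le> 1" using \<delta> by (simp add: field_simps) (smt (verit) one_le_power)
    finally have "\<bar>Re (h z - poly (f (Suc n)) z)\<bar> \<le> 1" using abs_Re_le_cmod order_trans by blast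
    then show "T n \<le> Re (h z)" using large[OF i z] by simp
  qed
qed

text \<open>The zeros in a compact disc are finite in number, so only finitely many radii are bad,
  and a short interval of radii to the right of a good one stays good. Constant functions fall
  outside the finiteness theorem and are treated separately.\<close>

lemma zero_free_annulus:
  assumes f: "f holomorphic_on S" "open S" "connected S" and nz: "\<exists>z\<in>S. f z \<noteq> 0"
    and R: "0 \<le> R" "R < R'" "cball 0 R' \<subseteq> S"
  obtains a b where "R < a" "a < b" "b < R'" "\<And>z. a \<le> norm z \<Longrightarrow> norm z \<le> b \<Longrightarrow> f z \<noteq> 0"
proof -
  have "finite {z \<in> cball 0 R'. f z = 0}"
  proof (cases "f constant_on S")
    case True
    then have "{z \<in> cball 0 R'. f z = 0} = {}" using nz R(3) by (auto simp: constant_on_def)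
    then show ?thesis by (metis finite.emptyI)
  qed (rule holomorphic_compact_finite_zeros[OF f compact_cball R(3)])
  then have fin: "finite (norm ` {z \<in> cball 0 R'. f z = 0})" (is "finite ?Z") by simp
  have "open ({R<..<R'} - ?Z)"
    using fin by (intro open_Diff finite_imp_closed) auto
  moreover have "infinite ({R<..<R'} - ?Z)"
    using R fin by (simp add: Diff_infinite_finite)
  then obtain a where "a \<in> {R<..<R'} - ?Z" by (metis ex_in_conv finite.emptyI)
  ultimately obtain r where r: "r > 0" "ball a r \<subseteq> {R<..<R'} - ?Z"
    using openE by blast
  have *: "x \<in> {R<..<R'} - ?Z" if "a \<le> x" "x \<le> a + r / 2" for x
    using r that by (intro subsetD[OF r(2)]) (auto simp: dist_real_def)
  show ?thesis
  proof
    show "R < a" "a + r / 2 < R'" "a < a + r / 2"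
      using *[of a] *[of "a + r / 2"] r by auto
    fix z :: complex assume "a \<le> norm z" "norm z \<le> a + r / 2"
    then have "norm z \<notin> ?Z" "norm z < R'" using *[of "norm z"] by auto
    then show "f z \<noteq> 0" by force
  qed
qed

lemma norm_exhaustion:
  assumes "S = UNIV \<or> S = ball (0::complex) 1" "compact K" "K \<subseteq> S"
  obtains R :: "nat \<Rightarrow> real" where "strict_mono R" "R 0 \<ge> 1 / 4" "K \<subseteq> cball 0 (R 0)"
    "\<And>n. cball 0 (R n) \<subseteq> S" "\<And>z. z \<in> S \<Longrightarrow> \<exists>n. norm z < R n"
  using assms(1)
proof
  assume S: "S = UNIV"
  obtain M where M: "M > 0" "\<forall>z\<in>K. norm z \<le> M"
    using compact_imp_bounded[OF assms(2)] by (auto simp: bounded_pos)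
  show thesis
  proof (rule that[of "\<lambda>n. M + 1 + real n"])
    show "\<exists>n. norm z < M + 1 + real n" for z :: complex
    proof -
      obtain n where "norm z < real n" using reals_Archimedean2 by blast
      then show ?thesis using M by (intro exI[of _ n]) linarith
    qed
  qed (use S M in \<open>auto simp: strict_mono_def\<close>)
next
  assume S: "S = ball 0 1"
  \<comment> \<open>A radius for \<open>K\<close>, raised to \<open>1 / 2\<close> so that the first
    disc is large enough for the slit level \<open>1 / 4\<close>; the radii
    \<open>1 - (1 - \<rho>) / (n + 1)\<close> start at \<open>\<rho>\<close> and increase to
    1.\<close>
  obtain \<rho> where \<rho>: "1 / 2 \<le> \<rho>" "\<rho> < 1" "\<And>z. z \<in> K \<Longrightarrow> norm z \<le> \<rho>"
  proof (cases "K = {}")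
    case False
    then obtain w where w: "w \<in> K" "\<And>z. z \<in> K \<Longrightarrow> norm z \<le> norm w"
      using continuous_attains_sup[OF assms(2), of norm] continuous_on_norm_id by blast
    then have "norm w < 1" using assms(3) S by auto
    then show ?thesis using that[of "max (1 / 2) (norm w)"] w(2) by force
  qed (use that[of "1 / 2"] in auto)
  show thesis
  proof (rule that[of "\<lambda>n. 1 - (1 - \<rho>) / (real n + 1)"])
    show "strict_mono (\<lambda>n. 1 - (1 - \<rho>) / (real n + 1))"
      using \<rho> by (intro strict_monoI) (simp add: divide_strict_left_mono)
    show "cball 0 (1 - (1 - \<rho>) / (real n + 1)) \<subseteq> S" for n
    proof -
      have "(1 - \<rho>) / (real n + 1) > 0" using \<rho> by simp
      then show ?thesis using S by auto
    qed
    show "\<exists>n. norm z < 1 - (1 - \<rho>) / (real n + 1)" if "z \<in> S" for z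
    proof -
      have "0 < 1 - norm z" using that S by simp
      then obtain n where "inverse (real (Suc n)) < 1 - norm z" using reals_Archimedean by blast
      moreover have "(1 - \<rho>) / (real n + 1) \<le> 1 / (real n + 1)"
        using \<rho> by (intro divide_right_mono) auto
      ultimately show ?thesis by (intro exI[of _ n]) (simp add: inverse_eq_divide add.commute)
    qed
  qed (use \<rho> in auto)
qed

section \<open>Weierstrass data\<close>

text \<open>From \<open>(Re w)^2 = (|w|^2 + Re (w^2)) / 2\<close> with \<open>w = f k * h\<close>:
  the null condition cancels the second terms. The result depends on \<open>h\<close> only through
  \<open>norm h\<close>, which is conformality.\<close>

lemma norm_Re_vector:
  fixes f :: "3 \<Rightarrow> complex"
  assumes "(\<Sum>k\<in>UNIV. (f k)\<^sup>2) = 0"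
  shows "(norm (\<chi> k. Re (f k * h) :: real^3))\<^sup>2 = (norm h)\<^sup>2 * (\<Sum>k\<in>UNIV. (norm (f k))\<^sup>2) / 2"
proof -
  have "(norm (\<chi> k. Re (f k * h) :: real^3))\<^sup>2 = (\<Sum>k\<in>UNIV. (Re (f k * h))\<^sup>2)"
    unfolding power2_norm_eq_inner by (simp add: inner_vec_def power2_eq_square)
  also have "\<dots> = (\<Sum>k\<in>UNIV. ((norm (f k * h))\<^sup>2 + Re ((f k * h)\<^sup>2)) / 2)"
  proof (rule sum.cong[OF refl])
    fix k
    show "(Re (f k * h))\<^sup>2 = ((norm (f k * h))\<^sup>2 + Re ((f k * h)\<^sup>2)) / 2"
      unfolding cmod_power2 Re_power2 by simp
  qed
  also have "\<dots> = ((\<Sum>k\<in>UNIV. (norm (f k * h))\<^sup>2) + Re (\<Sum>k\<in>UNIV. (f k * h)\<^sup>2)) / 2"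
    by (simp add: sum_divide_distrib[symmetric] sum.distrib)
  also have "(\<Sum>k\<in>UNIV. (f k * h)\<^sup>2) = (\<Sum>k\<in>UNIV. (f k)\<^sup>2) * h\<^sup>2"
    by (simp add: power_mult_distrib sum_distrib_right)
  also have "(\<Sum>k\<in>UNIV. (norm (f k * h))\<^sup>2) = (norm h)\<^sup>2 * (\<Sum>k\<in>UNIV. (norm (f k))\<^sup>2)"
    by (simp add: norm_mult power_mult_distrib sum_distrib_left mult.commute)
  finally show ?thesis using assms by simp
qed

text \<open>With \<open>f = Xx - i Xy\<close> componentwise, the real part of the sum of squares is
  \<open>|Xx|^2 - |Xy|^2\<close> and the imaginary part is \<open>-2\<close> times
  \<open>Xx \<bullet> Xy\<close>, so the null condition is conformality.\<close>

lemma conformal_minimal_immersion_data: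
  assumes "conformal_minimal_immersion S X"
  obtains f :: "3 \<Rightarrow> complex \<Rightarrow> complex" where
    "\<And>k. f k holomorphic_on S"
    "\<And>k z. z \<in> S \<Longrightarrow> ((\<lambda>z. X z $ k) has_derivative (\<lambda>h. Re (f k z * h))) (at z)"
    "\<And>z. z \<in> S \<Longrightarrow> (\<Sum>k\<in>UNIV. (f k z)\<^sup>2) = 0"
    "\<And>z. z \<in> S \<Longrightarrow> \<exists>k. f k z \<noteq> 0"
proof -
  have "\<exists>f. f holomorphic_on S \<and>
      (\<forall>z\<in>S. ((\<lambda>z. X z $ k) has_derivative (\<lambda>h. Re (f z * h))) (at z))" for k
  proof -
    have "harmonic_on S (\<lambda>z. X z $ k)"
      using assms unfolding conformal_minimal_immersion_def by blast
    then obtain f where "f holomorphic_on S"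
      "\<And>z. z \<in> S \<Longrightarrow> ((\<lambda>z. X z $ k) has_derivative (\<lambda>h. Re (f z * h))) (at z)"
      by (rule harmonic_on_imp_holomorphic) blast
    then show ?thesis by blast
  qed
  then obtain f where "\<And>k. f k holomorphic_on S \<and>
      (\<forall>z\<in>S. ((\<lambda>z. X z $ k) has_derivative (\<lambda>h. Re (f k z * h))) (at z))"
    by metis
  then have f: "\<And>k. f k holomorphic_on S"
    "\<And>k z. z \<in> S \<Longrightarrow> ((\<lambda>z. X z $ k) has_derivative (\<lambda>h. Re (f k z * h))) (at z)"
    by blast+
  obtain Xx Xy where X: "\<And>z. z \<in> S \<Longrightarrow> (X has_derivative (\<lambda>h. Re h *\<^sub>R Xx z + Im h *\<^sub>R Xy z)) (at z)"
    "\<And>z. z \<in> S \<Longrightarrow> norm (Xx z) = norm (Xy z)" "\<And>z. z \<in> S \<Longrightarrow> Xx z \<bullet> Xy z = 0"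
    "\<And>z. z \<in> S \<Longrightarrow> Xx z \<noteq> 0"
    using assms unfolding conformal_minimal_immersion_def by auto
  have eq: "Xx z $ k = Re (f k z)" "Xy z $ k = - Im (f k z)" if "z \<in> S" for z k
  proof -
    have "((\<lambda>z. X z $ k) has_derivative (\<lambda>h. (Re h *\<^sub>R Xx z + Im h *\<^sub>R Xy z) $ k)) (at z)"
      using bounded_linear.has_derivative[OF bounded_linear_vec_nth X(1)[OF that]] .
    from has_derivative_unique[OF this f(2)[OF that]]
    have "(Re h *\<^sub>R Xx z + Im h *\<^sub>R Xy z) $ k = Re (f k z * h)" for h by meson
    from this[of 1] this[of \<i>] show "Xx z $ k = Re (f k z)" "Xy z $ k = - Im (f k z)" by auto
  qed
  show ?thesis
  proof (rule that[OF f])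
    fix z assume z: "z \<in> S"
    have "(norm (Xx z))\<^sup>2 = (norm (Xy z))\<^sup>2" using X(2)[OF z] by simp
    then have "(\<Sum>k\<in>UNIV. (Re (f k z))\<^sup>2) = (\<Sum>k\<in>UNIV. (Im (f k z))\<^sup>2)"
      unfolding power2_norm_eq_inner by (simp add: inner_vec_def power2_eq_square eq[OF z])
    moreover have "(\<Sum>k\<in>UNIV. Re (f k z) * Im (f k z)) = 0"
      using X(3)[OF z] by (simp add: inner_vec_def eq[OF z] sum_negf)
    moreover have "Im (\<Sum>k\<in>UNIV. (f k z)\<^sup>2) = 2 * (\<Sum>k\<in>UNIV. Re (f k z) * Im (f k z))"
      by (simp add: Im_power2 sum_distrib_left mult.assoc)
    moreover have "Re (\<Sum>k\<in>UNIV. (f k z)\<^sup>2) = (\<Sum>k\<in>UNIV. (Re (f k z))\<^sup>2) - (\<Sum>k\<in>UNIV. (Im (f k z))\<^sup>2)"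
      by (simp add: Re_power2 sum_subtractf)
    ultimately show "(\<Sum>k\<in>UNIV. (f k z)\<^sup>2) = 0" by (simp add: complex_eq_iff)
    show "\<exists>k. f k z \<noteq> 0"
    proof (rule ccontr)
      assume "\<nexists>k. f k z \<noteq> 0"
      then have "Xx z = 0" using eq(1)[OF z] by (simp add: vec_eq_iff)
      then show False using X(4)[OF z] by blast
    qed
  qed
qed

text \<open>The way back: the norm formula in the directions 1 and i gives equal lengths, and the
  imaginary part of the null condition gives orthogonality. The second conclusion provides the total
  derivative on which the length estimates rest.\<close>

lemma conformal_minimal_immersionI:
  fixes f :: "3 \<Rightarrow> complex \<Rightarrow> complex"
  assumes S: "open S" and f: "\<And>k. f k holomorphic_on S"
    and X: "\<And>k z. z \<in> S \<Longrightarrow> ((\<lambda>z. X z $ k) has_derivative (\<lambda>h. Re (f k z * h))) (at z)"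
    and null: "\<And>z. z \<in> S \<Longrightarrow> (\<Sum>k\<in>UNIV. (f k z)\<^sup>2) = 0"
    and nz: "\<And>z. z \<in> S \<Longrightarrow> \<exists>k. f k z \<noteq> 0"
  shows "conformal_minimal_immersion S X"
    and "\<And>z. z \<in> S \<Longrightarrow> (X has_derivative (\<lambda>h. \<chi> k. Re (f k z * h))) (at z)"
proof -
  show D: "(X has_derivative (\<lambda>h. \<chi> k. Re (f k z * h))) (at z)" if "z \<in> S" for z
  proof -
    have "((\<lambda>w. X w \<bullet> i) has_derivative (\<lambda>h. (\<chi> k. Re (f k z * h)) \<bullet> i)) (at z)" if i: "i \<in> Basis" for i
    proof -
      obtain k where k: "i = axis k 1" using i by (auto simp: Basis_vec_def)
      show ?thesis using X[OF \<open>z \<in> S\<close>, of k] by (simp add: k inner_axis)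
    qed
    then show ?thesis using has_derivative_componentwise_within by blast
  qed
  define Xx Xy :: "complex \<Rightarrow> real^3" where "Xx = (\<lambda>z. \<chi> k. Re (f k z))" and "Xy = (\<lambda>z. \<chi> k. - Im (f k z))"
  have "(X has_derivative (\<lambda>h. Re h *\<^sub>R Xx z + Im h *\<^sub>R Xy z)) (at z) \<and>
       norm (Xx z) = norm (Xy z) \<and> Xx z \<bullet> Xy z = 0 \<and> Xx z \<noteq> 0" if z: "z \<in> S" for z
  proof (intro conjI)
    have "(\<lambda>h. \<chi> k. Re (f k z * h)) = (\<lambda>h. Re h *\<^sub>R Xx z + Im h *\<^sub>R Xy z)"
      by (simp add: vec_eq_iff fun_eq_iff Xx_def Xy_def algebra_simps)
    then show "(X has_derivative (\<lambda>h. Re h *\<^sub>R Xx z + Im h *\<^sub>R Xy z)) (at z)" using D[OF z] by simp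
    have Xx: "(norm (Xx z))\<^sup>2 = (\<Sum>k\<in>UNIV. (norm (f k z))\<^sup>2) / 2"
      using norm_Re_vector[OF null[OF z], of 1] by (simp add: Xx_def)
    moreover have "(norm (Xy z))\<^sup>2 = (\<Sum>k\<in>UNIV. (norm (f k z))\<^sup>2) / 2"
      using norm_Re_vector[OF null[OF z], of \<i>] by (simp add: Xy_def)
    ultimately have "(norm (Xx z))\<^sup>2 = (norm (Xy z))\<^sup>2" by linarith
    then show "norm (Xx z) = norm (Xy z)" by simp
    have "Im (\<Sum>k\<in>UNIV. (f k z)\<^sup>2) = 0" using null[OF z] by simp
    then have "(\<Sum>k\<in>UNIV. 2 * (Re (f k z) * Im (f k z))) = 0" by (simp add: power2_eq_square algebra_simps)
    then show "Xx z \<bullet> Xy z = 0"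
      by (simp add: inner_vec_def Xx_def Xy_def sum_negf sum_distrib_left[symmetric])
    obtain k where k: "f k z \<noteq> 0" using nz[OF z] by blast
    have "(norm (f k z))\<^sup>2 \<le> (\<Sum>k\<in>UNIV. (norm (f k z))\<^sup>2)" by (rule member_le_sum) auto
    moreover have "(norm (f k z))\<^sup>2 > 0" using k by simp
    ultimately have "(norm (Xx z))\<^sup>2 > 0" using Xx by linarith
    then show "Xx z \<noteq> 0" by auto
  qed
  moreover have "harmonic_on S (\<lambda>z. X z $ k)" for k
    using harmonic_on_Re_primitive[OF S f X] by blast
  ultimately show "conformal_minimal_immersion S X"
    unfolding conformal_minimal_immersion_def using S by blast
qed

text \<open>A further unit of length after every time can be collected again and again, and polygons
  over adjacent intervals concatenate.\<close>

lemma complete_immersionI: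
  assumes unit: "\<And>\<gamma> t. divergent_curve S \<gamma> \<Longrightarrow> 0 \<le> t \<Longrightarrow> t < 1 \<Longrightarrow>
    \<exists>u<1. \<exists>l\<ge>1. polygon_length (X \<circ> \<gamma>) t u l \<and> t \<le> u"
  shows "complete_immersion S X"
  unfolding complete_immersion_def
proof (intro allI impI)
  fix \<gamma> assume \<gamma>: "divergent_curve S \<gamma>"
  have long: "\<exists>t\<ge>0. t < 1 \<and> (\<exists>l\<ge>real j. polygon_length (X \<circ> \<gamma>) 0 t l)" for j
  proof (induction j)
    case 0
    show ?case using polygon_length.point by (intro exI[of _ 0]) auto
  next
    case (Suc j)
    then obtain t l where t: "0 \<le> t" "t < 1" "real j \<le> l" "polygon_length (X \<circ> \<gamma>) 0 t l" by blast
    obtain u l' where u: "u < 1" "1 \<le> l'" "polygon_length (X \<circ> \<gamma>) t u l'" "t \<le> u"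
      using unit[OF \<gamma> t(1,2)] by blast
    have "real (Suc j) \<le> l + l'" "0 \<le> u" using t u by auto
    then show ?case using polygon_length_trans[OF u(3) t(4)] u(1) by blast
  qed
  show "infinite_induced_length X \<gamma>"
    unfolding infinite_induced_length_def
  proof
    fix M :: real
    obtain j where "M < real j" using reals_Archimedean2 by blast
    then obtain t l where t: "t < 1" "M < l" "polygon_length (X \<circ> \<gamma>) 0 t l"
      using long[of j] by (meson less_le_trans)
    obtain n ts where "ts 0 = 0" "ts n = t" "\<And>i. i < n \<Longrightarrow> ts i < ts (Suc i)"
      "(\<Sum>i<n. norm ((X \<circ> \<gamma>) (ts (Suc i)) - (X \<circ> \<gamma>) (ts i))) = l"
      using polygon_length_partition[OF t(3)] by metis
    then show "\<exists>n ts. 0 \<le> ts 0 \<and> (\<forall>i<n. ts i < ts (Suc i)) \<and> ts n < 1 \<and>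
       M < (\<Sum>i<n. norm (X (\<gamma> (ts (Suc i))) - X (\<gamma> (ts i))))"
      using t by (intro exI[of _ n] exI[of _ ts]) simp
  qed
qed

lemma positive_lower_bound_annulus:
  assumes "continuous_on S f" "\<And>z. a \<le> norm z \<Longrightarrow> norm z \<le> b \<Longrightarrow> z \<in> S \<and> f z \<noteq> (0::complex)"
  obtains m where "m > 0" "\<And>z::complex. a \<le> norm z \<Longrightarrow> norm z \<le> b \<Longrightarrow> m \<le> norm (f z)"
proof (cases "{z::complex. a \<le> norm z \<and> norm z \<le> b} = {}")
  case True
  then show ?thesis using that[of 1] by auto
next
  case False
  have "closed {z::complex. a \<le> norm z \<and> norm z \<le> b}"
    by (intro closed_Collect_conj closed_Collect_le continuous_intros)
  moreover have "bounded {z::complex. a \<le> norm z \<and> norm z \<le> b}" unfolding bounded_iff by blast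
  ultimately have "compact {z::complex. a \<le> norm z \<and> norm z \<le> b}"
    by (simp add: compact_eq_bounded_closed)
  moreover have "continuous_on {z::complex. a \<le> norm z \<and> norm z \<le> b} (\<lambda>z. norm (f z))"
    using assms by (intro continuous_on_norm continuous_on_subset[OF assms(1)]) auto
  ultimately obtain w where "a \<le> norm w" "norm w \<le> b"
    "\<And>z. a \<le> norm z \<Longrightarrow> norm z \<le> b \<Longrightarrow> norm (f w) \<le> norm (f z)"
    using continuous_attains_inf[OF _ False] by blast
  then show ?thesis using that[of "norm (f w)"] assms(2)[of w] by auto
qed

text \<open>With \<open>A = f 1 - \<i> f 2\<close> and \<open>B = f 1 + \<i> f 2\<close>, this replaces \<open>A\<close> by \<open>A e\<^bsup>h\<^esup>\<close> and \<open>B\<close> by \<open>B e\<^bsup>-h\<^esup>\<close>,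
  which keeps \<open>A B = - (f 3)\<^sup>2\<close>.\<close>

definition deform :: "(complex \<Rightarrow> complex) \<Rightarrow> (3 \<Rightarrow> complex \<Rightarrow> complex) \<Rightarrow> 3 \<Rightarrow> complex \<Rightarrow> complex" where
  "deform h f k z =
    (if k = 1 then ((f 1 z - \<i> * f 2 z) * exp (h z) + (f 1 z + \<i> * f 2 z) * exp (- h z)) / 2
     else if k = 2 then \<i> * ((f 1 z - \<i> * f 2 z) * exp (h z) - (f 1 z + \<i> * f 2 z) * exp (- h z)) / 2
     else f 3 z)"

lemma three_cases: "k = 1 \<or> k = 2 \<or> k = (3::3)"
  using exhaust_3 by auto

lemma deform_simps:
  "deform h f 1 z = ((f 1 z - \<i> * f 2 z) * exp (h z) + (f 1 z + \<i> * f 2 z) * exp (- h z)) / 2"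
  "deform h f 2 z = \<i> * ((f 1 z - \<i> * f 2 z) * exp (h z) - (f 1 z + \<i> * f 2 z) * exp (- h z)) / 2"
  "deform h f 3 z = f 3 z"
  by (simp_all add: deform_def)

text \<open>Solving these two equations for the first two components gives the formula in
  \<open>deform\<close>; the null condition, nonvanishing and the metric bound are read off from
  them.\<close>

lemma deform_linear:
  "deform h f 1 z - \<i> * deform h f 2 z = (f 1 z - \<i> * f 2 z) * exp (h z)"
  "deform h f 1 z + \<i> * deform h f 2 z = (f 1 z + \<i> * f 2 z) * exp (- h z)"
  by (simp_all add: deform_simps field_simps)

lemma deform_holomorphic:
  assumes "\<And>k. f k holomorphic_on S" "h holomorphic_on S"
  shows "deform h f k holomorphic_on S"
proof -
  have "deform h f 1 holomorphic_on S" "deform h f 2 holomorphic_on S" "deform h f 3 holomorphic_on S"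
    unfolding deform_simps[abs_def] by (intro holomorphic_intros assms; simp)+
  then show ?thesis using three_cases[of k] by auto
qed

lemma deform_null:
  assumes "(\<Sum>k\<in>UNIV. (f k z)\<^sup>2) = 0"
  shows "(\<Sum>k\<in>UNIV. (deform h f k z)\<^sup>2) = 0"
proof -
  have "(deform h f 1 z)\<^sup>2 + (deform h f 2 z)\<^sup>2
      = (deform h f 1 z - \<i> * deform h f 2 z) * (deform h f 1 z + \<i> * deform h f 2 z)"
    by (simp add: power2_eq_square algebra_simps)
  also have "\<dots> = (f 1 z - \<i> * f 2 z) * (f 1 z + \<i> * f 2 z) * (exp (h z) * exp (- h z))"
    by (simp add: deform_linear)
  also have "\<dots> = (f 1 z)\<^sup>2 + (f 2 z)\<^sup>2"
    by (simp add: exp_minus_inverse power2_eq_square algebra_simps)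
  finally show ?thesis using assms by (simp add: sum_3 deform_simps(3))
qed

lemma deform_nonzero:
  assumes "\<exists>k. f k z \<noteq> 0"
  shows "\<exists>k. deform h f k z \<noteq> 0"
proof (rule ccontr)
  assume "\<nexists>k. deform h f k z \<noteq> 0"
  then have 0: "deform h f k z = 0" for k by blast
  have "f 1 z - \<i> * f 2 z = 0" "f 1 z + \<i> * f 2 z = 0"
    using deform_linear[of h f z] 0 by auto
  moreover have "f 3 z = 0" using 0[of 3] by (simp add: deform_simps(3))
  ultimately have "f 1 z = 0" "f 2 z = 0" "f 3 z = 0" by (auto simp: algebra_simps)
  then show False using assms three_cases by metis
qed

text \<open>The norm formula gives the square of the norm as \<open>(norm v)^2 * Q / 2\<close>, so
  every \<open>x\<close> with \<open>x^2 \<le> 2 * Q\<close> yields the lower bound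
  \<open>x / 2\<close>. For the second claim \<open>x = |g 1 - i g 2|\<close>, whose square is at
  most \<open>2 (|g 1|^2 + |g 2|^2)\<close>.\<close>

lemma deform_norm_ge:
  fixes v :: complex
  assumes null: "(\<Sum>k\<in>UNIV. (f k z)\<^sup>2) = 0"
  shows "norm (f 3 z) / 2 * norm v \<le> norm (\<chi> k. Re (deform h f k z * v) :: real^3)"
    and "norm (f 1 z - \<i> * f 2 z) * exp (Re (h z)) / 2 * norm v
      \<le> norm (\<chi> k. Re (deform h f k z * v) :: real^3)"
proof -
  define g where "g = (\<lambda>k. deform h f k z)"
  define Q where "Q = (norm (g 1))\<^sup>2 + (norm (g 2))\<^sup>2 + (norm (g 3))\<^sup>2"
  have n: "(norm (\<chi> k. Re (g k * v) :: real^3))\<^sup>2 = (norm v)\<^sup>2 * Q / 2"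
    using norm_Re_vector[of g v] deform_null[of f z h, OF null] by (simp add: g_def Q_def sum_3)
  have bound: "x / 2 * norm v \<le> norm (\<chi> k. Re (g k * v) :: real^3)" if "x\<^sup>2 \<le> 2 * Q" for x
  proof (rule power2_le_imp_le)
    have "(norm v)\<^sup>2 * x\<^sup>2 \<le> (norm v)\<^sup>2 * (2 * Q)" using that by (intro mult_left_mono) auto
    then show "(x / 2 * norm v)\<^sup>2 \<le> (norm (\<chi> k. Re (g k * v) :: real^3))\<^sup>2"
      unfolding n by (simp add: power_mult_distrib power_divide field_simps)
  qed simp
  have "norm (g 1 - \<i> * g 2) \<le> norm (g 1) + norm (g 2)"
    using norm_triangle_ineq4[of "g 1" "\<i> * g 2"] by (simp add: norm_mult)
  then have "(norm (g 1 - \<i> * g 2))\<^sup>2 \<le> (norm (g 1) + norm (g 2))\<^sup>2" by (intro power_mono) auto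
  also have "\<dots> \<le> 2 * ((norm (g 1))\<^sup>2 + (norm (g 2))\<^sup>2)"
    using sum_squares_bound[of "norm (g 1)" "norm (g 2)"] by (simp add: power2_sum)
  also have "\<dots> \<le> 2 * Q" by (simp add: Q_def)
  finally have "(norm (f 1 z - \<i> * f 2 z) * exp (Re (h z)))\<^sup>2 \<le> 2 * Q"
    using deform_linear(1)[of h f z] by (simp add: g_def norm_mult)
  from bound[OF this] show "norm (f 1 z - \<i> * f 2 z) * exp (Re (h z)) / 2 * norm v
      \<le> norm (\<chi> k. Re (deform h f k z * v) :: real^3)" by (simp add: g_def)
  have "(norm (f 3 z))\<^sup>2 \<le> 2 * Q" by (simp add: Q_def g_def deform_simps(3))
  from bound[OF this] show "norm (f 3 z) / 2 * norm v \<le> norm (\<chi> k. Re (deform h f k z * v) :: real^3)"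
    by (simp add: g_def)
qed

text \<open>Up to factors of modulus 1 the changes in the first two components are half the sum and
  half the difference of \<open>A (e^h - 1)\<close> and \<open>B (e^(-h) - 1)\<close>.\<close>

lemma deform_close:
  assumes "norm (exp (h z) - 1) \<le> \<eta>" "norm (exp (- h z) - 1) \<le> \<eta>"
    and "norm (f 1 z) \<le> M" "norm (f 2 z) \<le> M"
  shows "norm (deform h f k z - f k z) \<le> 2 * M * \<eta>"
proof -
  define A B where "A = f 1 z - \<i> * f 2 z" and "B = f 1 z + \<i> * f 2 z"
  have AB: "norm A \<le> 2 * M" "norm B \<le> 2 * M"
    using assms(3,4) norm_triangle_ineq4[of "f 1 z" "\<i> * f 2 z"] norm_triangle_ineq[of "f 1 z" "\<i> * f 2 z"]
    by (auto simp: A_def B_def norm_mult)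
  have \<eta>: "0 \<le> \<eta>" "0 \<le> M" using assms norm_ge_zero order_trans by blast+
  define u v where "u = A * (exp (h z) - 1)" and "v = B * (exp (- h z) - 1)"
  have uv: "norm u \<le> 2 * M * \<eta>" "norm v \<le> 2 * M * \<eta>"
    unfolding u_def v_def norm_mult using AB assms(1,2) \<eta> by (auto intro!: mult_mono)
  have "norm ((u + v) / 2) \<le> 2 * M * \<eta>" "norm (\<i> * (u - v) / 2) \<le> 2 * M * \<eta>"
    using norm_triangle_ineq[of u v] norm_triangle_ineq4[of u v] uv by (auto simp: norm_mult norm_divide)
  moreover have "deform h f 1 z - f 1 z = (u + v) / 2" "deform h f 2 z - f 2 z = \<i> * (u - v) / 2"
    by (simp_all add: deform_simps u_def v_def A_def B_def field_simps)
  ultimately have "norm (deform h f 1 z - f 1 z) \<le> 2 * M * \<eta>" "norm (deform h f 2 z - f 2 z) \<le> 2 * M * \<eta>"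
    by (simp_all only:)
  moreover have "norm (deform h f 3 z - f 3 z) \<le> 2 * M * \<eta>" using \<eta> by (simp add: deform_simps(3))
  ultimately show ?thesis using three_cases[of k] by auto
qed

section \<open>The completion\<close>

theorem theorem1p1:
  fixes S :: "complex set" and X :: "complex \<Rightarrow> real^3" and K :: "complex set" and \<epsilon> :: real
  assumes "S = UNIV \<or> S = ball 0 1"
    and "conformal_minimal_immersion S X"
    and "\<not> (\<exists>c. \<forall>z\<in>S. X z $ 3 = c)"
    and "compact K" and "K \<subseteq> S"
    and "\<epsilon> > 0"
  shows "\<exists>Y. conformal_minimal_immersion S Y \<and> complete_immersion S Y \<and>
             (\<forall>z\<in>K. norm (X z - Y z) < \<epsilon>) \<and>
             (\<forall>z\<in>S. Y z $ 3 = X z $ 3)"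
proof -

  \<comment> \<open>Holomorphic data of \<open>X\<close> and the third differential\<close>
  have S: "open S" "convex S" "0 \<in> S" using assms(1) by auto
  obtain f :: "3 \<Rightarrow> complex \<Rightarrow> complex" where f: "\<And>k. f k holomorphic_on S"
    and X: "\<And>k z. z \<in> S \<Longrightarrow> ((\<lambda>z. X z $ k) has_derivative (\<lambda>h. Re (f k z * h))) (at z)"
    and null: "\<And>z. z \<in> S \<Longrightarrow> (\<Sum>k\<in>UNIV. (f k z)\<^sup>2) = 0"
    and nz: "\<And>z. z \<in> S \<Longrightarrow> \<exists>k. f k z \<noteq> 0"
    using conformal_minimal_immersion_data[OF assms(2)] by blast
  have f3: "\<exists>z\<in>S. f 3 z \<noteq> 0"
  proof (rule ccontr)
    assume "\<not> ?thesis"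
    then have "((\<lambda>z. X z $ 3) has_derivative (\<lambda>h. 0)) (at z within S)" if "z \<in> S" for z
      using X[OF that, of 3] that by (auto intro: has_derivative_at_withinI)
    then have "\<exists>c. \<forall>z\<in>S. X z $ 3 = c" by (rule has_derivative_zero_constant[OF S(2)])
    then show False using assms(3) by blast
  qed

  \<comment> \<open>Disjoint annuli and the parameters of their labyrinths\<close>
  obtain R :: "nat \<Rightarrow> real" where R: "strict_mono R" "R 0 \<ge> 1 / 4" "K \<subseteq> cball 0 (R 0)"
    "\<And>n. cball 0 (R n) \<subseteq> S" "\<And>z. z \<in> S \<Longrightarrow> \<exists>n. norm z < R n"
    by (rule norm_exhaustion[OF assms(1,4,5)]) blast
  have Rpos: "0 \<le> R n" for n
    using monoD[OF strict_mono_mono[OF R(1)], of 0 n] R(2) by simp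
  have "\<exists>a b. R n < a \<and> a < b \<and> b < R (Suc n) \<and> (\<forall>z. a \<le> norm z \<longrightarrow> norm z \<le> b \<longrightarrow> f 3 z \<noteq> 0)" for n
  proof -
    have "R n < R (Suc n)" using R(1) by (simp add: strict_mono_def)
    then obtain a b where "R n < a" "a < b" "b < R (Suc n)"
      "\<And>z. a \<le> norm z \<Longrightarrow> norm z \<le> b \<Longrightarrow> f 3 z \<noteq> 0"
      by (rule zero_free_annulus[OF f S(1) convex_connected[OF S(2)] f3 Rpos _ R(4)]) blast
    then show ?thesis by blast
  qed
  then obtain a b where ab: "\<And>n. R n < a n" "\<And>n. a n < b n" "\<And>n. b n < R (Suc n)"
    and f3_nz: "\<And>n z. a n \<le> norm z \<Longrightarrow> norm z \<le> b n \<Longrightarrow> f 3 z \<noteq> 0"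
    by metis
  have inS: "z \<in> S" if "norm z \<le> b n" for n z
    using R(4)[of "Suc n"] ab(3)[of n] that by (auto simp: subset_iff)
  define A where "A = (\<lambda>z. f 1 z - \<i> * f 2 z)"
  have A_nz: "A z \<noteq> 0" if "a n \<le> norm z" "norm z \<le> b n" for n z
  proof
    assume "A z = 0"
    then have "f 1 z = \<i> * f 2 z" by (simp add: A_def)
    then have "(f 3 z)\<^sup>2 = 0" using null[OF inS[OF that(2)]] by (simp add: sum_3 power_mult_distrib)
    then show False using f3_nz[OF that] by simp
  qed
  \<comment> \<open>The order of choice matters: \<open>m\<close> comes from the minimum of
    \<open>|f 3|\<close>, \<open>N\<close> from \<open>m\<close>, and \<open>d\<close> from
    \<open>N\<close> so that \<open>N\<close> free annuli and \<open>N\<close> rings fill the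
    annulus exactly. \<open>T\<close> comes last, since the stretching \<open>2 / d\<close> required
    on the rings grows with \<open>N\<close>.\<close>
  have "\<exists>m N d T. m > 0 \<and> (real N - 1) * m \<ge> 4 \<and> d > 0 \<and> a n + 2 * real N * d = b n \<and>
    (\<forall>z. a n \<le> norm z \<longrightarrow> norm z \<le> b n \<longrightarrow> m \<le> norm (f 3 z) / 2 \<and> 2 / d \<le> norm (A z) * exp T / 2)" for n
  proof -
    have cont: "continuous_on S (f 3)" "continuous_on S A"
      unfolding A_def by (intro continuous_intros holomorphic_on_imp_continuous_on f)+
    obtain m where m: "m > 0" "\<And>z. a n \<le> norm z \<Longrightarrow> norm z \<le> b n \<Longrightarrow> m \<le> norm (f 3 z)"
      by (rule positive_lower_bound_annulus[OF cont(1), of "a n" "b n"]) (use inS f3_nz in blast)+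
    obtain \<alpha> where \<alpha>: "\<alpha> > 0" "\<And>z. a n \<le> norm z \<Longrightarrow> norm z \<le> b n \<Longrightarrow> \<alpha> \<le> norm (A z)"
      by (rule positive_lower_bound_annulus[OF cont(2), of "a n" "b n"]) (use inS A_nz in blast)+
    obtain N where N: "8 / m + 1 < real N" using reals_Archimedean2 by blast
    then have "(real N - 1) * (m / 2) \<ge> 4" using m(1) by (simp add: field_simps)
    moreover have "real N > 0" using N m(1) by (smt (verit) divide_pos_pos)
    ultimately have N': "(real N - 1) * (m / 2) \<ge> 4" "real N > 0" by blast+
    define d where "d = (b n - a n) / (2 * real N)"
    have d: "d > 0" "a n + 2 * real N * d = b n" using ab(2)[of n] N'(2) by (auto simp: d_def)
    \<comment> \<open>Chosen so that \<open>\<alpha> * exp T = 4 / d\<close>; the metric bound takes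
      half of this.\<close>
    define T where "T = ln (4 / (d * \<alpha>))"
    have "\<alpha> * exp T = 4 / d" using d \<alpha> by (simp add: T_def)
    moreover have "\<alpha> * exp T \<le> norm (A z) * exp T" if "a n \<le> norm z" "norm z \<le> b n" for z
      using \<alpha>(2)[OF that] by simp
    ultimately have "2 / d \<le> norm (A z) * exp T / 2" if "a n \<le> norm z" "norm z \<le> b n" for z
      using that by fastforce
    then show ?thesis
      using m N' d by (intro exI[of _ "m / 2"] exI[of _ N] exI[of _ d] exI[of _ T]) auto
  qed
  then obtain m N d T where m: "\<And>n. m n > 0" and N: "\<And>n. (real (N n) - 1) * m n \<ge> 4"
    and d: "\<And>n. d n > 0" "\<And>n. a n + 2 * real (N n) * d n = b n"
    and lower: "\<And>n z. a n \<le> norm z \<Longrightarrow> norm z \<le> b n \<Longrightarrow> m n \<le> norm (f 3 z) / 2"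
      "\<And>n z. a n \<le> norm z \<Longrightarrow> norm z \<le> b n \<Longrightarrow> 2 / d n \<le> norm (A z) * exp (T n) / 2"
    by metis

  \<comment> \<open>Constants for closeness on \<open>K\<close>\<close>
  obtain M where M: "M > 0" "\<And>z. norm z \<le> a 0 \<Longrightarrow> norm (f 1 z) \<le> M" "\<And>z. norm z \<le> a 0 \<Longrightarrow> norm (f 2 z) \<le> M"
  proof -
    have sub: "cball 0 (a 0) \<subseteq> S" using inS[of _ 0] ab(2)[of 0] by auto
    have "bounded (f k ` cball 0 (a 0))" for k
      by (intro compact_imp_bounded compact_continuous_image compact_cball
          continuous_on_subset[OF holomorphic_on_imp_continuous_on[OF f] sub])
    then obtain M1 M2 where "\<forall>x\<in>f 1 ` cball 0 (a 0). norm x \<le> M1" "\<forall>x\<in>f 2 ` cball 0 (a 0). norm x \<le> M2"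
      unfolding bounded_iff by meson
    then show ?thesis by (intro that[of "max 1 (max M1 M2)"]) (auto simp: le_max_iff_disj)
  qed
  have a0: "a 0 > 0" using ab(1)[of 0] R(2) by simp
  \<comment> \<open>On the disc of radius \<open>a 0\<close> each coordinate will move by at most
    \<open>2 * M * \<eta> * a 0\<close>, and the norm is at most the sum over three coordinates. The
    summand 1 in the denominator makes the inequality strict.\<close>
  define \<eta> where "\<eta> = \<epsilon> / (6 * M * a 0 + 1)"
  have \<eta>: "\<eta> > 0" "3 * (2 * M * \<eta> * a 0) < \<epsilon>"
    using assms(6) M(1) a0 by (auto simp: \<eta>_def field_simps add_pos_pos)
  obtain e where e: "e > 0" "\<And>w::complex. norm w < e \<Longrightarrow> norm (exp w - 1) \<le> \<eta>"
  proof -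
    have "isCont (exp :: complex \<Rightarrow> complex) 0" by simp
    then obtain e where "e > 0" "\<forall>w::complex. dist w 0 < e \<longrightarrow> dist (exp w) (exp 0) < \<eta>"
      using \<eta>(1) unfolding continuous_at_eps_delta by blast
    then show ?thesis by (intro that[of e]) (auto simp: dist_norm intro: less_imp_le)
  qed
  have a4: "a 0 \<ge> 1 / 4" using ab(1)[of 0] R(2) by simp
  have next_a: "a n + 2 * real (N n) * d n \<le> a (Suc n)" for n
    using d(2)[of n] ab(3)[of n] ab(1)[of "Suc n"] by linarith
  have exhaust: "\<exists>n. norm z < a n" if "z \<in> S" for z
    using R(5)[OF that] ab(1) less_trans by blast
  obtain h where h: "h holomorphic_on S" "\<And>z. norm z \<le> a 0 \<Longrightarrow> norm (h z) < e"
    "\<And>n i z. i < N n \<Longrightarrow> z \<in> layer (a n) (d n) i \<Longrightarrow> T n \<le> Re (h z)"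
    by (rule holomorphic_large_on_layers[of S a d e N T, OF S(1) a4 d(1) e(1) next_a exhaust], assumption) (rule that, assumption+)

  \<comment> \<open>The deformed immersion\<close>
  define g where "g = deform h f"
  have g: "g k holomorphic_on S" for k
    unfolding g_def by (rule deform_holomorphic[OF f h(1)])
  \<comment> \<open>Integrating \<open>g - f\<close> instead of \<open>g\<close> presents
    \<open>Y\<close> as a perturbation of \<open>X\<close>, so closeness becomes a bound on
    \<open>G\<close>. The primitive exists because \<open>S\<close> is convex.\<close>
  have "\<exists>G. (\<forall>z\<in>S. (G has_field_derivative (g k z - f k z)) (at z)) \<and> G 0 = 0" for k
  proof -
    have "(\<lambda>z. g k z - f k z) holomorphic_on S" by (intro holomorphic_intros f g)
    then obtain G where G: "\<And>z. z \<in> S \<Longrightarrow> (G has_field_derivative (g k z - f k z)) (at z within S)"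
      by (rule holomorphic_convex_primitive'[OF S(2,1)]) blast
    have "((\<lambda>z. G z - G 0) has_field_derivative (g k z - f k z)) (at z)" if "z \<in> S" for z
      using DERIV_diff[OF G[OF that] DERIV_const[of "G 0"]] by (simp add: at_within_open[OF that S(1)])
    then show ?thesis by (intro exI[of _ "\<lambda>z. G z - G 0"]) auto
  qed
  then obtain G where G: "\<And>k z. z \<in> S \<Longrightarrow> (G k has_field_derivative (g k z - f k z)) (at z)"
    and G0: "\<And>k. G k 0 = 0" by metis
  \<comment> \<open>Serves twice: on the disc of radius \<open>a 0\<close> with a small
    \<open>B\<close> for closeness, and on all of \<open>S\<close> with \<open>B = 0\<close> for the
    third coordinate, where \<open>g 3 = f 3\<close>.\<close>
  have G_bound: "norm (G k z) \<le> B * norm z"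
    if "convex U" "0 \<in> U" "U \<subseteq> S" "\<And>w. w \<in> U \<Longrightarrow> norm (g k w - f k w) \<le> B" "z \<in> U" for U k B z
  proof -
    have "(G k has_field_derivative (g k w - f k w)) (at w within U)" if "w \<in> U" for w
      by (rule has_field_derivative_at_within[OF G[OF subsetD[OF \<open>U \<subseteq> S\<close> that]]])
    from field_differentiable_bound[OF that(1) this that(4,5,2)] show ?thesis by (simp add: G0)
  qed
  define Y :: "complex \<Rightarrow> real^3" where "Y = (\<lambda>z. \<chi> k. X z $ k + Re (G k z))"
  have Yd: "((\<lambda>z. Y z $ k) has_derivative (\<lambda>v. Re (g k z * v))) (at z)" if "z \<in> S" for k z
  proof -
    have "((\<lambda>z. Re (G k z)) has_derivative (\<lambda>v. Re ((g k z - f k z) * v))) (at z)"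
      using has_derivative_Re[OF G[OF that, unfolded has_field_derivative_def]] .
    from has_derivative_add[OF X[OF that, of k] this]
    show ?thesis by (simp add: Y_def algebra_simps)
  qed
  have gnull: "(\<Sum>k\<in>UNIV. (g k z)\<^sup>2) = 0" if "z \<in> S" for z
    unfolding g_def by (rule deform_null[where f = f, OF null[OF that]])
  have gnz: "\<exists>k. g k z \<noteq> 0" if "z \<in> S" for z
    unfolding g_def by (rule deform_nonzero[where f = f, OF nz[OF that]])
  have Y: "conformal_minimal_immersion S Y"
    by (rule conformal_minimal_immersionI(1)[OF S(1) g Yd gnull gnz])
  have YD: "(Y has_derivative (\<lambda>v. \<chi> k. Re (g k z * v))) (at z)" if "z \<in> S" for z
    by (rule conformal_minimal_immersionI(2)[OF S(1) g Yd gnull gnz]) (use that in auto)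

  \<comment> \<open>Lower bounds for the metric of \<open>Y\<close>\<close>
  have annulus: "\<exists>D. (Y has_derivative D) (at z) \<and> (\<forall>v. m n * norm v \<le> norm (D v))"
    if "a n \<le> norm z" "norm z \<le> b n" for n z
  proof -
    have z: "z \<in> S" using inS that by blast
    have "m n * norm v \<le> norm (\<chi> k. Re (g k z * v) :: real^3)" for v
    proof -
      have "m n * norm v \<le> norm (f 3 z) / 2 * norm v" using lower(1)[OF that] by (intro mult_right_mono) auto
      also have "\<dots> \<le> norm (\<chi> k. Re (g k z * v) :: real^3)"
        unfolding g_def by (rule deform_norm_ge(1)[where f = f, OF null[OF z]])
      finally show ?thesis .
    qed
    then show ?thesis using YD[OF z] by blast
  qed
  have layers: "\<exists>D. (Y has_derivative D) (at z) \<and> (\<forall>v. 2 / d n * norm v \<le> norm (D v))"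
    if i: "i < N n" and zl: "z \<in> layer (a n) (d n) i" for n i z
  proof -
    have "(2 * real i + 2) * d n \<le> 2 * real (N n) * d n" "0 \<le> (2 * real i + 1) * d n"
      using i d(1)[of n] by (auto intro!: mult_right_mono)
    then have az: "a n \<le> norm z" "norm z \<le> b n" using zl d(2)[of n] unfolding layer_def by auto
    have z: "z \<in> S" using inS az by blast
    have "norm (A z) * exp (T n) \<le> norm (A z) * exp (Re (h z))"
      using h(3)[OF i zl] by (intro mult_left_mono) auto
    then have le: "2 / d n \<le> norm (A z) * exp (Re (h z)) / 2" using lower(2)[OF az] by simp
    have "2 / d n * norm v \<le> norm (\<chi> k. Re (g k z * v) :: real^3)" for v
    proof -
      have "2 / d n * norm v \<le> norm (A z) * exp (Re (h z)) / 2 * norm v"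
        using le by (intro mult_right_mono) auto
      also have "\<dots> \<le> norm (\<chi> k. Re (g k z * v) :: real^3)"
        unfolding g_def A_def by (rule deform_norm_ge(2)[where f = f, OF null[OF z]])
      finally show ?thesis .
    qed
    then show ?thesis using YD[OF z] by blast
  qed

  \<comment> \<open>Completeness\<close>
  have "complete_immersion S Y"
  proof (rule complete_immersionI)
    fix \<gamma> and t :: real
    assume \<gamma>: "divergent_curve S \<gamma>" and t: "0 \<le> t" "t < 1"
    \<comment> \<open>The annulus is chosen afresh for each starting time: it lies beyond
      \<open>\<gamma> t\<close>, and divergence takes the curve out of the disc of radius
      \<open>b n\<close>, so this annulus is crossed after \<open>t\<close>.\<close>
    have "\<gamma> t \<in> S" using \<gamma> t by (auto simp: divergent_curve_def)
    then obtain n where "norm (\<gamma> t) < R n" using R(5) by blast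
    then have n: "norm (\<gamma> t) \<le> a n" using ab(1)[of n] by simp
    have "compact (cball (0::complex) (b n)) \<and> cball 0 (b n) \<subseteq> S" using inS by auto
    then obtain t0 where t0: "t0 < 1" "\<And>x. x \<in> {t0..<1} \<Longrightarrow> \<gamma> x \<notin> cball 0 (b n)"
      using \<gamma> unfolding divergent_curve_def by meson
    define u where "u = max t t0"
    have u: "t \<le> u" "u < 1" "b n \<le> norm (\<gamma> u)" using t t0(1) t0(2)[of u] by (auto simp: u_def)
    have cont: "continuous_on {t..u} \<gamma>"
      using \<gamma> t u unfolding divergent_curve_def by (auto elim: continuous_on_subset)
    have "\<exists>l\<ge>1. polygon_length (Y \<circ> \<gamma>) t u l"
    proof (rule annulus_crossing_length[OF u(1) cont n _ d(1) m N])
      show "a n + 2 * real (N n) * d n \<le> norm (\<gamma> u)" using u(3) d(2)[of n] by simp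
      show "\<exists>D. (Y has_derivative D) (at z) \<and> (\<forall>h. m n * norm h \<le> norm (D h))"
        if "a n \<le> norm z" "norm z \<le> a n + 2 * real (N n) * d n" for z
        by (rule annulus) (use that d(2)[of n] in simp_all)
      show "\<exists>D. (Y has_derivative D) (at z) \<and> (\<forall>h. 2 / d n * norm h \<le> norm (D h))"
        if "i < N n" "z \<in> layer (a n) (d n) i" for i z
        by (rule layers[OF that])
    qed
    then show "\<exists>u<1. \<exists>l\<ge>1. polygon_length (Y \<circ> \<gamma>) t u l \<and> t \<le> u" using u by blast
  qed

  \<comment> \<open>Closeness on \<open>K\<close> and equality of the third coordinates\<close>
  moreover have "norm (X z - Y z) < \<epsilon>" if "z \<in> K" for z
  proof -
    have z: "norm z \<le> a 0" using R(3) that ab(1)[of 0] by fastforce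
    have "norm (G k z) \<le> 2 * M * \<eta> * a 0" for k
    proof -
      have "norm (g k w - f k w) \<le> 2 * M * \<eta>" if "w \<in> cball 0 (a 0)" for w
        unfolding g_def using that h(2)[of w] M(2,3)[of w]
        by (intro deform_close e(2)) auto
      then have "norm (G k z) \<le> 2 * M * \<eta> * norm z"
        using z a0 ab(2)[of 0] inS[of _ 0] by (intro G_bound[of "cball 0 (a 0)"]) auto
      also have "\<dots> \<le> 2 * M * \<eta> * a 0" using z M(1) \<eta>(1) by (intro mult_left_mono) auto
      finally show ?thesis .
    qed
    then have "\<bar>(X z - Y z) $ k\<bar> \<le> 2 * M * \<eta> * a 0" for k
      using abs_Re_le_cmod[of "G k z"] order_trans by (fastforce simp: Y_def)
    then have "(\<Sum>k\<in>UNIV. \<bar>(X z - Y z) $ k\<bar>) \<le> 3 * (2 * M * \<eta> * a 0)"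
      using sum_bounded_above[of "UNIV :: 3 set" "\<lambda>k. \<bar>(X z - Y z) $ k\<bar>" "2 * M * \<eta> * a 0"] by simp
    then show ?thesis using norm_le_l1_cart[of "X z - Y z"] \<eta>(2) by linarith
  qed
  moreover have "Y z $ 3 = X z $ 3" if "z \<in> S" for z
  proof -
    have "norm (G 3 z) \<le> 0 * norm z"
      using S that by (intro G_bound[of S]) (auto simp: g_def deform_simps(3))
    then show ?thesis by (simp add: Y_def)
  qed
  ultimately show ?thesis using Y by blast
qed

end
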